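(* If $L$ and $L'$ are finite semidistrim lattices, then the product lattice $L\times L'$ (ordered componentwise) is semidistrim.
   Context: All lattices are finite. For a lattice $L$, $\mathcal{J}_L$ (resp. $\mathcal{M}_L$) is the set of join-irreducible (resp. meet-irreducible) elements; for $j\in\mathcal{J}_L$, $j_*$ is the unique element covered by $j$, and for $m\in\mathcal{M}_L$, $m^*$ is the unique element covering $m$. Let $\mathcal{M}_L(j)=\max\{z\in L: j_*=j\wedge z\}$ and $\mathcal{J}_L(m)=\min\{z\in L: m^*=m\vee z\}$. A pairing on $L$ is a bijection $\kappa:\mathcal{J}_L\to\mathcal{M}_L$ with $\kappa(j)\in\mathcal{M}_L(j)$ for all $j$ and $\kappa^{-1}(m)\in\mathcal{J}_L(m)$ for all $m$; $L$ is uniquely paired if it has exactly one pairing, denoted $\kappa_L$. A prime pair is a pair $(j_0,m_0)$ with $L=[\hat0,m_0]\sqcup[j_0,\hat1]$. A uniquely paired lattice $L$ is compatibly dismantlable if $|L|=1$ or there is a prime pair $(j_0,m_0)$ such that: (i) $[j_0,\hat1]$ is compatibly dismantlable and $\alpha(j)=j_0\vee j$ defines a bijection $\{j\in\mathcal{J}_L: j_0\le\kappa_L(j)\}\to\mathcal{J}_{[j_0,\hat1]}$ with $\kappa_{[j_0,\hat1]}(\alpha(j))=\kappa_L(j)$; (ii) $[\hat0,m_0]$ is compatibly dismantlable and $\beta(m)=m_0\wedge m$ defines a bijection $\{m\in\mathcal{M}_L:\kappa_L^{-1}(m)\le m_0\}\to\mathcal{M}_{[\hat0,m_0]}$ with $\kappa_{[\hat0,m_0]}^{-1}(\beta(m))=\kappa_L^{-1}(m)$.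 The Galois graph $G_L$ is the directed graph on $\mathcal{J}_L$ with an edge $j\to j'$ iff $j\ne j'$ and $j\not\le\kappa_L(j')$. For $x\in L$ let $J_L(x)=\{j\in\mathcal{J}_L:j\le x\}$ and $M_L(x)=\{j\in\mathcal{J}_L:\kappa_L(j)\ge x\}$. For a compatibly dismantlable $L$, for every cover $x\lessdot y$ the set $M_L(x)\cap J_L(y)$ has exactly one element $j_{xy}$; set $\mathcal{D}_L(x)=\{j_{yx}:y\lessdot x\}$ and $\mathcal{U}_L(x)=\{j_{xy}:x\lessdot y\}$. $L$ is semidistrim if it is compatibly dismantlable and $\mathcal{D}_L(x)$, $\mathcal{U}_L(x)$ are independent sets (no two elements adjacent) of $G_L$ for all $x\in L$. *)

theory Defs
  imports "HOL-Algebra.Lattice" "Graph_Theory.Pair_Digraph"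
begin

section \<open>Finite lattices, intervals and products\<close>

definition finite_lattice :: "'a gorder \<Rightarrow> bool" where
  "finite_lattice L \<longleftrightarrow> lattice L \<and> finite (carrier L) \<and> carrier L \<noteq> {}"

definition interval :: "'a gorder \<Rightarrow> 'a \<Rightarrow> 'a \<Rightarrow> 'a gorder" where
  "interval L a b = L\<lparr>carrier := \<lbrace>a..b\<rbrace>\<^bsub>L\<^esub>\<rparr>"

text \<open>The equivalence built into \<^type>\<open>gorder\<close> is plain equality here, as
  the locale \<^const>\<open>lattice\<close> requires.\<close>

definition prod_lattice :: "'a gorder \<Rightarrow> 'b gorder \<Rightarrow> ('a \<times> 'b) gorder" where
  "prod_lattice L L' =
     \<lparr>carrier = carrier L \<times> carrier L',
      eq = (=),
      le = (\<lambda>(x, x') (y, y'). x \<sqsubseteq>\<^bsub>L\<^esub> y \<and> x' \<sqsubseteq>\<^bsub>L'\<^esub> y')\<rparr>"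

definition covered_by :: "'a gorder \<Rightarrow> 'a \<Rightarrow> 'a \<Rightarrow> bool" where
  "covered_by L x y \<longleftrightarrow> x \<in> carrier L \<and> y \<in> carrier L \<and> x \<sqsubset>\<^bsub>L\<^esub> y \<and>
     \<not> (\<exists>z\<in>carrier L. x \<sqsubset>\<^bsub>L\<^esub> z \<and> z \<sqsubset>\<^bsub>L\<^esub> y)"


section \<open>Irreducible elements\<close>

definition join_irreducibles :: "'a gorder \<Rightarrow> 'a set" where
  "join_irreducibles L = {j \<in> carrier L. \<exists>!x. covered_by L x j}"

definition meet_irreducibles :: "'a gorder \<Rightarrow> 'a set" where
  "meet_irreducibles L = {m \<in> carrier L. \<exists>!x. covered_by L m x}"

definition lower_cover :: "'a gorder \<Rightarrow> 'a \<Rightarrow> 'a" where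
  "lower_cover L j = (THE x. covered_by L x j)"

definition upper_cover :: "'a gorder \<Rightarrow> 'a \<Rightarrow> 'a" where
  "upper_cover L m = (THE x. covered_by L m x)"


section \<open>Pairings\<close>

definition maximal_in :: "'a gorder \<Rightarrow> 'a set \<Rightarrow> 'a set" where
  "maximal_in L S = {z \<in> S. \<forall>w\<in>S. z \<sqsubseteq>\<^bsub>L\<^esub> w \<longrightarrow> w = z}"

definition minimal_in :: "'a gorder \<Rightarrow> 'a set \<Rightarrow> 'a set" where
  "minimal_in L S = {z \<in> S. \<forall>w\<in>S. w \<sqsubseteq>\<^bsub>L\<^esub> z \<longrightarrow> w = z}"

text \<open>The ``max'' in the definition of \<open>\<M>\<^sub>L(j)\<close> is the set of all maximal elements,
  and dually for \<open>\<J>\<^sub>L(m)\<close>.\<close>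

definition meet_partners :: "'a gorder \<Rightarrow> 'a \<Rightarrow> 'a set" where
  "meet_partners L j = maximal_in L {z \<in> carrier L. lower_cover L j = j \<sqinter>\<^bsub>L\<^esub> z}"

definition join_partners :: "'a gorder \<Rightarrow> 'a \<Rightarrow> 'a set" where
  "join_partners L m = minimal_in L {z \<in> carrier L. upper_cover L m = m \<squnion>\<^bsub>L\<^esub> z}"

text \<open>Extensionality makes a pairing a function on the join-irreducible elements only, so
  that uniqueness of the pairing does not depend on values elsewhere.\<close>

definition pairing :: "'a gorder \<Rightarrow> ('a \<Rightarrow> 'a) \<Rightarrow> bool" where
  "pairing L \<kappa> \<longleftrightarrow>
     \<kappa> \<in> extensional (join_irreducibles L) \<and>
     bij_betw \<kappa> (join_irreducibles L) (meet_irreducibles L) \<and>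
     (\<forall>j\<in>join_irreducibles L. \<kappa> j \<in> meet_partners L j) \<and>
     (\<forall>m\<in>meet_irreducibles L. inv_into (join_irreducibles L) \<kappa> m \<in> join_partners L m)"

definition uniquely_paired :: "'a gorder \<Rightarrow> bool" where
  "uniquely_paired L \<longleftrightarrow> finite_lattice L \<and> (\<exists>!\<kappa>. pairing L \<kappa>)"

definition kappa :: "'a gorder \<Rightarrow> 'a \<Rightarrow> 'a" where
  "kappa L = (THE \<kappa>. pairing L \<kappa>)"

definition kappa_inv :: "'a gorder \<Rightarrow> 'a \<Rightarrow> 'a" where
  "kappa_inv L = inv_into (join_irreducibles L) (kappa L)"


section \<open>Compatibly dismantlable lattices\<close>

definition prime_pair :: "'a gorder \<Rightarrow> 'a \<Rightarrow> 'a \<Rightarrow> bool" where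
  "prime_pair L j\<^sub>0 m\<^sub>0 \<longleftrightarrow> j\<^sub>0 \<in> carrier L \<and> m\<^sub>0 \<in> carrier L \<and>
     carrier L = \<lbrace>\<bottom>\<^bsub>L\<^esub>..m\<^sub>0\<rbrace>\<^bsub>L\<^esub> \<union> \<lbrace>j\<^sub>0..\<top>\<^bsub>L\<^esub>\<rbrace>\<^bsub>L\<^esub> \<and>
     \<lbrace>\<bottom>\<^bsub>L\<^esub>..m\<^sub>0\<rbrace>\<^bsub>L\<^esub> \<inter> \<lbrace>j\<^sub>0..\<top>\<^bsub>L\<^esub>\<rbrace>\<^bsub>L\<^esub> = {}"

definition compatible_above :: "'a gorder \<Rightarrow> 'a \<Rightarrow> bool" where
  "compatible_above L j\<^sub>0 \<longleftrightarrow>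
     (let U = interval L j\<^sub>0 \<top>\<^bsub>L\<^esub>; A = {j \<in> join_irreducibles L. j\<^sub>0 \<sqsubseteq>\<^bsub>L\<^esub> kappa L j} in
      bij_betw (\<lambda>j. j\<^sub>0 \<squnion>\<^bsub>L\<^esub> j) A (join_irreducibles U) \<and>
      (\<forall>j\<in>A. kappa U (j\<^sub>0 \<squnion>\<^bsub>L\<^esub> j) = kappa L j))"

definition compatible_below :: "'a gorder \<Rightarrow> 'a \<Rightarrow> bool" where
  "compatible_below L m\<^sub>0 \<longleftrightarrow>
     (let D = interval L \<bottom>\<^bsub>L\<^esub> m\<^sub>0; B = {m \<in> meet_irreducibles L. kappa_inv L m \<sqsubseteq>\<^bsub>L\<^esub> m\<^sub>0} in
      bij_betw (\<lambda>m. m\<^sub>0 \<sqinter>\<^bsub>L\<^esub> m) B (meet_irreducibles D) \<and>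
      (\<forall>m\<in>B. kappa_inv D (m\<^sub>0 \<sqinter>\<^bsub>L\<^esub> m) = kappa_inv L m))"

inductive compatibly_dismantlable :: "'a gorder \<Rightarrow> bool" where
  trivial:
    "\<lbrakk>uniquely_paired L; card (carrier L) = 1\<rbrakk> \<Longrightarrow> compatibly_dismantlable L"
| dismantle:
    "\<lbrakk>uniquely_paired L; prime_pair L j\<^sub>0 m\<^sub>0;
      compatibly_dismantlable (interval L j\<^sub>0 \<top>\<^bsub>L\<^esub>); compatible_above L j\<^sub>0;
      compatibly_dismantlable (interval L \<bottom>\<^bsub>L\<^esub> m\<^sub>0); compatible_below L m\<^sub>0\<rbrakk>
     \<Longrightarrow> compatibly_dismantlable L"


section \<open>Semidistrim lattices\<close>

definition galois_graph :: "'a gorder \<Rightarrow> 'a pair_pre_digraph" where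
  "galois_graph L =
     \<lparr>pverts = join_irreducibles L,
      parcs = {(j, j'). j \<in> join_irreducibles L \<and> j' \<in> join_irreducibles L \<and>
                        j \<noteq> j' \<and> \<not> j \<sqsubseteq>\<^bsub>L\<^esub> kappa L j'}\<rparr>"

definition independent_in :: "'a pair_pre_digraph \<Rightarrow> 'a set \<Rightarrow> bool" where
  "independent_in G S \<longleftrightarrow> S \<subseteq> pverts G \<and> (\<forall>u\<in>S. \<forall>v\<in>S. (u, v) \<notin> parcs G)"

definition J_set :: "'a gorder \<Rightarrow> 'a \<Rightarrow> 'a set" where
  "J_set L x = {j \<in> join_irreducibles L. j \<sqsubseteq>\<^bsub>L\<^esub> x}"

definition M_set :: "'a gorder \<Rightarrow> 'a \<Rightarrow> 'a set" where
  "M_set L x = {j \<in> join_irreducibles L. x \<sqsubseteq>\<^bsub>L\<^esub> kappa L j}"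

text \<open>The label \<open>j\<^bsub>xy\<^esub>\<close> of a cover; the intersection is a singleton whenever
  \<open>L\<close> is compatibly dismantlable and \<open>y\<close> covers \<open>x\<close>.\<close>

definition cover_label :: "'a gorder \<Rightarrow> 'a \<Rightarrow> 'a \<Rightarrow> 'a" where
  "cover_label L x y = (THE j. j \<in> M_set L x \<inter> J_set L y)"

definition down_labels :: "'a gorder \<Rightarrow> 'a \<Rightarrow> 'a set" where
  "down_labels L x = {cover_label L y x | y. covered_by L y x}"

definition up_labels :: "'a gorder \<Rightarrow> 'a \<Rightarrow> 'a set" where
  "up_labels L x = {cover_label L x y | y. covered_by L x y}"

definition semidistrim :: "'a gorder \<Rightarrow> bool" where
  "semidistrim L \<longleftrightarrow> compatibly_dismantlable L \<and>
     (\<forall>x\<in>carrier L. independent_in (galois_graph L) (down_labels L x) \<and>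
                     independent_in (galois_graph L) (up_labels L x))"

end

theory Submission
  imports Defs
begin

text \<open>The join-irreducible elements of \<open>L \<times> L'\<close> are the pairs \<open>(j, \<bottom>)\<close> and \<open>(\<bottom>, j')\<close>, and the
  partners of \<open>(j, \<bottom>)\<close> are the pairs \<open>(m, \<top>)\<close> with \<open>m\<close> a partner of \<open>j\<close>. Hence the pairings of the
  product are the pairs of pairings of the factors, with \<open>\<kappa>(j, \<bottom>) = (\<kappa>(j), \<top>)\<close>. A prime pair
  \<open>(j\<^sub>0, m\<^sub>0)\<close> of \<open>L\<close> gives the prime pair \<open>((j\<^sub>0, \<bottom>), (m\<^sub>0, \<top>))\<close> of the product, whose two intervals
  are products \<open>[j\<^sub>0, \<top>] \<times> L'\<close> and \<open>[\<bottom>, m\<^sub>0] \<times> L'\<close>, so one factor after the other can be dismantled.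
  A cover of the product moves one coordinate only and is labelled by the label of that coordinate;
  labels coming from different factors are never adjacent, since \<open>(j, \<bottom>) \<le> (\<top>, \<kappa>(j'))\<close>.\<close>

section \<open>Finite lattices and their products\<close>

locale fin_lat = lattice L for L :: "'a gorder" (structure) +
  assumes finite_carrier: "finite (carrier L)" and carrier_nonempty: "carrier L \<noteq> {}"

text \<open>The meet and the join of the whole carrier exist by finiteness and are the
  bounds.\<close>

sublocale fin_lat \<subseteq> bounded_lattice L
proof
  show "\<exists>x. least L x (carrier L)"
    using finite_inf_greatest[OF finite_carrier subset_refl carrier_nonempty]
    unfolding greatest_def least_def Lower_def by blast
  show "\<exists>x. greatest L x (carrier L)"
    using finite_sup_least[OF finite_carrier subset_refl carrier_nonempty]
    unfolding greatest_def least_def Upper_def by blast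
qed

lemma fin_lat_iff: "fin_lat L \<longleftrightarrow> finite_lattice L"
  by (simp add: fin_lat_def fin_lat_axioms_def finite_lattice_def)

lemma fin_lat_if_uniquely_paired: "uniquely_paired L \<Longrightarrow> fin_lat L"
  by (simp add: uniquely_paired_def fin_lat_iff)

context fin_lat

\<comment> \<open>Duality, covers and irreducibles in one finite lattice\<close>
begin

\<comment> \<open>As an introduction rule for equations it makes the classical reasoner diverge.\<close>
declare le_antisym [rule del]

text \<open>Order reversal saves half of the proofs: upper covers, \<open>meet_irreducibles\<close>
  and \<open>join_partners\<close> of \<open>L\<close> are the lower covers,
  \<open>join_irreducibles\<close> and \<open>meet_partners\<close> of
  \<open>inv_gorder L\<close>.\<close>

lemma fin_lat_dual: "fin_lat (inv_gorder L)"
  using dual_lattice finite_carrier carrier_nonempty by (simp add: fin_lat_iff finite_lattice_def)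

lemma covered_by_dual: "covered_by (inv_gorder L) x y \<longleftrightarrow> covered_by L y x"
  by (auto simp: covered_by_def lless_def eq_is_equal)

lemma join_irreducibles_dual: "join_irreducibles (inv_gorder L) = meet_irreducibles L"
  by (simp add: join_irreducibles_def meet_irreducibles_def covered_by_dual)

lemma lower_cover_dual: "lower_cover (inv_gorder L) = upper_cover L"
  by (simp add: fun_eq_iff lower_cover_def upper_cover_def covered_by_dual)

lemma meet_partners_dual: "meet_partners (inv_gorder L) = join_partners L"
  by (simp add: fun_eq_iff meet_partners_def join_partners_def maximal_in_def minimal_in_def
      lower_cover_dual)

lemma join_irreducibles_closed: "j \<in> join_irreducibles L \<Longrightarrow> j \<in> carrier L"
  by (simp add: join_irreducibles_def)

lemma meet_irreducibles_closed: "m \<in> meet_irreducibles L \<Longrightarrow> m \<in> carrier L"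
  by (simp add: meet_irreducibles_def)

lemma bottom_not_covered: "\<not> covered_by L x \<bottom>"
  using le_antisym[of x \<bottom>] by (auto simp: covered_by_def lless_eq)

text \<open>If \<open>z\<close> is not itself covered by \<open>x\<close>, some \<open>u\<close>
  lies strictly between them, and the induction continues with the smaller interval from
  \<open>u\<close> to \<open>x\<close>.\<close>

lemma ex_lower_cover_between:
  assumes "z \<in> carrier L" "x \<in> carrier L" "z \<sqsubseteq> x" "z \<noteq> x"
  shows "\<exists>w. covered_by L w x \<and> z \<sqsubseteq> w"
  using assms
proof (induction "card {w \<in> carrier L. z \<sqsubseteq> w \<and> w \<sqsubseteq> x}" arbitrary: z rule: less_induct)
  case less
  show ?case
  proof (cases "covered_by L z x")
    case False
    then obtain u where u: "u \<in> carrier L" "z \<sqsubset> u" "u \<sqsubset> x"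
      using less.prems by (auto simp: covered_by_def lless_eq)
    \<comment> \<open>The inclusion is strict at \<open>z\<close>, which by antisymmetry is not
      above \<open>u\<close>.\<close>
    have "{w \<in> carrier L. u \<sqsubseteq> w \<and> w \<sqsubseteq> x} \<subset> {w \<in> carrier L. z \<sqsubseteq> w \<and> w \<sqsubseteq> x}"
      using u less.prems le_trans[of z u] le_antisym[of u z] by (auto simp: lless_eq)
    then have "card {w \<in> carrier L. u \<sqsubseteq> w \<and> w \<sqsubseteq> x} < card {w \<in> carrier L. z \<sqsubseteq> w \<and> w \<sqsubseteq> x}"
      using finite_carrier by (intro psubset_card_mono) auto
    with less u obtain w where w: "covered_by L w x" "u \<sqsubseteq> w"
      by (auto simp: lless_eq)
    moreover have "z \<sqsubseteq> w"
      using u w less.prems le_trans[of z u w] by (auto simp: lless_eq covered_by_def)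
    ultimately show ?thesis by blast
  qed (use less.prems in auto)
qed

lemma no_lower_cover_iff:
  "x \<in> carrier L \<Longrightarrow> (\<nexists>w. covered_by L w x) \<longleftrightarrow> x = \<bottom>"
  using ex_lower_cover_between[of \<bottom> x] bottom_not_covered by auto

lemma bottom_not_join_irreducible: "\<bottom> \<notin> join_irreducibles L"
  using bottom_not_covered by (auto simp: join_irreducibles_def)

lemma top_not_meet_irreducible: "\<top> \<notin> meet_irreducibles L"
  using fin_lat.bottom_not_join_irreducible[OF fin_lat_dual]
  by (simp add: join_irreducibles_dual)

lemma lower_cover_eq:
  assumes "j \<in> join_irreducibles L" "covered_by L x j" shows "lower_cover L j = x"
  using assms unfolding lower_cover_def join_irreducibles_def by (auto intro: the1_equality)

lemma covered_by_lower_cover: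
  assumes "j \<in> join_irreducibles L" shows "covered_by L (lower_cover L j) j"
  using assms unfolding lower_cover_def join_irreducibles_def by (auto intro: theI')

text \<open>An element strictly below \<open>j\<close> lies below some lower cover of
  \<open>j\<close>, and \<open>j\<close> has only one.\<close>

lemma le_lower_cover:
  assumes "j \<in> join_irreducibles L" "z \<in> carrier L" "z \<sqsubseteq> j" "z \<noteq> j"
  shows "z \<sqsubseteq> lower_cover L j"
proof -
  obtain w where "covered_by L w j" "z \<sqsubseteq> w"
    using ex_lower_cover_between[of z j] assms join_irreducibles_closed by blast
  then show ?thesis using lower_cover_eq[OF assms(1)] by simp
qed

lemma meet_partners_closed: "m \<in> meet_partners L j \<Longrightarrow> m \<in> carrier L"
  by (simp add: meet_partners_def maximal_in_def)

lemma meet_partnersD: "m \<in> meet_partners L j \<Longrightarrow> j \<sqinter> m = lower_cover L j"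
  by (simp add: meet_partners_def maximal_in_def)

lemma not_le_meet_partner:
  assumes j: "j \<in> join_irreducibles L" and m: "m \<in> meet_partners L j"
  shows "\<not> j \<sqsubseteq> m"
proof
  assume "j \<sqsubseteq> m"
  then have "j \<sqinter> m = j"
    using le_iff_join[of j m] j m by (simp add: join_irreducibles_closed meet_partners_closed)
  then show False
    using covered_by_lower_cover[OF j] meet_partnersD[OF m] by (simp add: covered_by_def lless_eq)
qed

lemma meet_eqI:
  assumes "i \<in> carrier L" "x \<in> carrier L" "y \<in> carrier L" "i \<sqsubseteq> x" "i \<sqsubseteq> y"
    and "\<And>z. z \<in> carrier L \<Longrightarrow> z \<sqsubseteq> x \<Longrightarrow> z \<sqsubseteq> y \<Longrightarrow> z \<sqsubseteq> i"
  shows "x \<sqinter> y = i"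
proof (rule le_antisym)
  show "x \<sqinter> y \<sqsubseteq> i" "i \<sqsubseteq> x \<sqinter> y"
    using assms by (simp_all add: meet_le meet_left meet_right)
qed (use assms in simp_all)

text \<open>As \<open>k\<close> is bijective, each meet-irreducible \<open>m\<close> can be written
  as \<open>k j\<close>, which turns the condition on the inverse into one on \<open>j\<close> and
  removes \<open>inv_into\<close>.\<close>

lemma pairing_iff:
  "pairing L k \<longleftrightarrow> k \<in> extensional (join_irreducibles L) \<and>
     bij_betw k (join_irreducibles L) (meet_irreducibles L) \<and>
     (\<forall>j\<in>join_irreducibles L. k j \<in> meet_partners L j \<and> j \<in> join_partners L (k j))"
proof (cases "bij_betw k (join_irreducibles L) (meet_irreducibles L)")
  case True
  then have im: "meet_irreducibles L = k ` join_irreducibles L"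
    and inj: "inj_on k (join_irreducibles L)"
    by (auto simp: bij_betw_def)
  show ?thesis
    unfolding pairing_def im using True inj by (auto simp: inv_into_f_f im)
qed (simp add: pairing_def)

end

lemma pairing_kappa: "uniquely_paired L \<Longrightarrow> pairing L (kappa L)"
  unfolding uniquely_paired_def kappa_def by (elim conjE) (rule theI'[of "pairing L"])

lemma kappa_eq: "uniquely_paired L \<Longrightarrow> pairing L k \<Longrightarrow> kappa L = k"
  unfolding uniquely_paired_def kappa_def by (elim conjE) (rule the1_equality)

lemma bij_betw_kappa:
  "uniquely_paired L \<Longrightarrow> bij_betw (kappa L) (join_irreducibles L) (meet_irreducibles L)"
  using pairing_kappa by (auto simp: pairing_def)

lemma kappa_mem: "uniquely_paired L \<Longrightarrow> j \<in> join_irreducibles L \<Longrightarrow> kappa L j \<in> meet_irreducibles L"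
  using bij_betw_kappa bij_betwE by blast

lemma kappa_closed: "uniquely_paired L \<Longrightarrow> j \<in> join_irreducibles L \<Longrightarrow> kappa L j \<in> carrier L"
  using kappa_mem by (fastforce simp: meet_irreducibles_def)

lemma kappa_meet_partner:
  "uniquely_paired L \<Longrightarrow> j \<in> join_irreducibles L \<Longrightarrow> kappa L j \<in> meet_partners L j"
  using pairing_kappa by (auto simp: pairing_def)

lemma kappa_inv_kappa:
  "uniquely_paired L \<Longrightarrow> j \<in> join_irreducibles L \<Longrightarrow> kappa_inv L (kappa L j) = j"
  unfolding kappa_inv_def by (rule inv_into_f_f[OF bij_betw_imp_inj_on[OF bij_betw_kappa]])

lemma kappa_kappa_inv:
  "uniquely_paired L \<Longrightarrow> m \<in> meet_irreducibles L \<Longrightarrow> kappa L (kappa_inv L m) = m"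
  unfolding kappa_inv_def by (simp add: f_inv_into_f bij_betw_imp_surj_on[OF bij_betw_kappa])

lemma kappa_inv_mem:
  "uniquely_paired L \<Longrightarrow> m \<in> meet_irreducibles L \<Longrightarrow> kappa_inv L m \<in> join_irreducibles L"
  unfolding kappa_inv_def by (simp add: inv_into_into bij_betw_imp_surj_on[OF bij_betw_kappa])

lemma not_le_kappa:
  assumes "uniquely_paired L" "j \<in> join_irreducibles L" shows "\<not> j \<sqsubseteq>\<^bsub>L\<^esub> kappa L j"
  using fin_lat.not_le_meet_partner[OF fin_lat_if_uniquely_paired] kappa_meet_partner assms by metis

section \<open>Order, covers, irreducibles and partners of a product\<close>

lemma carrier_prod_lattice [simp]: "carrier (prod_lattice L L') = carrier L \<times> carrier L'"
  by (simp add: prod_lattice_def)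

lemma eq_prod_lattice [simp]: "eq (prod_lattice L L') = (=)"
  by (simp add: prod_lattice_def)

lemma le_prod_lattice [simp]:
  "(x, x') \<sqsubseteq>\<^bsub>prod_lattice L L'\<^esub> (y, y') \<longleftrightarrow> x \<sqsubseteq>\<^bsub>L\<^esub> y \<and> x' \<sqsubseteq>\<^bsub>L'\<^esub> y'"
  by (simp add: prod_lattice_def)

text \<open>Raising one coordinate while keeping the other stays inside \<open>S \<times> T\<close>,
  so maximality can be tested in each coordinate separately.\<close>

lemma maximal_in_Times:
  assumes "fin_lat L" "fin_lat L'" "S \<subseteq> carrier L" "T \<subseteq> carrier L'"
  shows "maximal_in (prod_lattice L L') (S \<times> T) = maximal_in L S \<times> maximal_in L' T"
proof -
  interpret A: fin_lat L by fact
  interpret B: fin_lat L' by fact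
  show ?thesis
    using assms(3,4) by (auto simp: maximal_in_def; blast)
qed

locale two_fin_lats = A: fin_lat L + B: fin_lat L' for L :: "'a gorder" and L' :: "'b gorder"
begin

abbreviation "P \<equiv> prod_lattice L L'"

lemma fin_lat_prod: "fin_lat P"
proof -
  have po: "partial_order P"
  proof (unfold_locales, goal_cases)
    \<comment> \<open>Goals 5 and 6 are antisymmetry and transitivity; the others are reflexivity
      and facts about \<open>eq\<close>, which is plain equality.\<close>
    case (5 p q)
    then show ?case
      by (cases p; cases q) (simp add: A.le_antisym B.le_antisym)
  next
    case (6 p q r)
    then show ?case
      by (cases p; cases q; cases r) (simp, metis A.le_trans B.le_trans)
  qed (simp_all add: mem_Times_iff split_paired_all)
  have "\<exists>s. least P s (Upper P {p, q})" if "p \<in> carrier P" "q \<in> carrier P" for p q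
  proof -
    obtain x x' y y' where [simp]: "p = (x, x')" "q = (y, y')"
      by fastforce
    have "least P (x \<squnion>\<^bsub>L\<^esub> y, x' \<squnion>\<^bsub>L'\<^esub> y') (Upper P {p, q})"
      using that
      by (simp add: least_def Upper_def A.join_left A.join_right B.join_left B.join_right
          A.join_le B.join_le split_paired_all Ball_def Collect_conj_eq[symmetric])
    then show ?thesis ..
  qed
  moreover have "\<exists>s. greatest P s (Lower P {p, q})" if "p \<in> carrier P" "q \<in> carrier P" for p q
  proof -
    obtain x x' y y' where [simp]: "p = (x, x')" "q = (y, y')"
      by fastforce
    have "greatest P (x \<sqinter>\<^bsub>L\<^esub> y, x' \<sqinter>\<^bsub>L'\<^esub> y') (Lower P {p, q})"
      using that
      by (simp add: greatest_def Lower_def A.meet_left A.meet_right B.meet_left B.meet_right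
          A.meet_le B.meet_le split_paired_all Ball_def)
    then show ?thesis ..
  qed
  ultimately have "lattice P"
    using po by (simp add: lattice_def upper_semilattice_def lower_semilattice_def
        upper_semilattice_axioms_def lower_semilattice_axioms_def)
  then show ?thesis
    using A.finite_carrier B.finite_carrier A.carrier_nonempty B.carrier_nonempty
    by (simp add: fin_lat_def fin_lat_axioms_def)
qed

sublocale P: fin_lat P
  by (rule fin_lat_prod)

text \<open>Reversal commutes with the product, so the dual of a product lemma is that lemma for the
  reversed factors.\<close>

lemma dual_prod_lattice: "inv_gorder P = prod_lattice (inv_gorder L) (inv_gorder L')"
  by (auto simp: prod_lattice_def fun_eq_iff)

lemma two_fin_lats_dual: "two_fin_lats (inv_gorder L) (inv_gorder L')"
  using A.fin_lat_dual B.fin_lat_dual by (simp add: two_fin_lats_def)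

lemma bottom_prod: "\<bottom>\<^bsub>P\<^esub> = (\<bottom>\<^bsub>L\<^esub>, \<bottom>\<^bsub>L'\<^esub>)"
  by (rule P.bottom_eq[symmetric]) auto

lemma top_prod: "\<top>\<^bsub>P\<^esub> = (\<top>\<^bsub>L\<^esub>, \<top>\<^bsub>L'\<^esub>)"
  by (rule P.top_eq[symmetric]) auto

lemma meet_prod:
  assumes "x \<in> carrier L" "y \<in> carrier L" "x' \<in> carrier L'" "y' \<in> carrier L'"
  shows "(x, x') \<sqinter>\<^bsub>P\<^esub> (y, y') = (x \<sqinter>\<^bsub>L\<^esub> y, x' \<sqinter>\<^bsub>L'\<^esub> y')"
  using assms
  by (intro P.meet_eqI) (auto intro: A.meet_left A.meet_right B.meet_left B.meet_right A.meet_le B.meet_le)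

lemma join_prod:
  assumes "x \<in> carrier L" "y \<in> carrier L" "x' \<in> carrier L'" "y' \<in> carrier L'"
  shows "(x, x') \<squnion>\<^bsub>P\<^esub> (y, y') = (x \<squnion>\<^bsub>L\<^esub> y, x' \<squnion>\<^bsub>L'\<^esub> y')"
proof -
  interpret D: two_fin_lats "inv_gorder L" "inv_gorder L'"
    by (rule two_fin_lats_dual)
  show ?thesis
    using D.meet_prod[of x y x' y'] assms
    by (simp add: dual_prod_lattice[symmetric] del: eq_prod_lattice carrier_prod_lattice)
qed

text \<open>The mixed pair \<open>(x, y')\<close> lies between the two ends of a cover and so equals
  one of them; hence one coordinate stays fixed.\<close>

lemma covered_by_prod:
  "covered_by P (x, x') (y, y') \<longleftrightarrow>
     covered_by L x y \<and> x' = y' \<and> x' \<in> carrier L' \<or> x = y \<and> x \<in> carrier L \<and> covered_by L' x' y'"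
  (is "?l \<longleftrightarrow> ?r")
proof
  assume l: ?l
  then have le: "x \<sqsubseteq>\<^bsub>L\<^esub> y" "x' \<sqsubseteq>\<^bsub>L'\<^esub> y'" "(x, x') \<noteq> (y, y')"
    and c: "x \<in> carrier L" "y \<in> carrier L" "x' \<in> carrier L'" "y' \<in> carrier L'"
    by (auto simp: covered_by_def P.lless_eq)
  from l have btw: "z = x \<and> z' = x' \<or> z = y \<and> z' = y'" if "z \<in> carrier L" "z' \<in> carrier L'"
      "x \<sqsubseteq>\<^bsub>L\<^esub> z" "z \<sqsubseteq>\<^bsub>L\<^esub> y" "x' \<sqsubseteq>\<^bsub>L'\<^esub> z'" "z' \<sqsubseteq>\<^bsub>L'\<^esub> y'" for z z'
    using that c le by (auto simp: covered_by_def P.lless_eq)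
  have "x = y \<or> x' = y'"
    using btw[of x y'] le c by auto
  then show ?r
    using le c btw[of _ x'] btw[of x]
    by (auto simp: covered_by_def A.lless_eq B.lless_eq)
next
  assume r: ?r
  then show ?l
  proof (elim disjE)
    assume "covered_by L x y \<and> x' = y' \<and> x' \<in> carrier L'"
    \<comment> \<open>Anything in between has its second coordinate squeezed between
      \<open>x'\<close> and \<open>x'\<close>.\<close>
    then show ?l
      using B.le_antisym[of _ x'] by (auto simp: covered_by_def P.lless_eq A.lless_eq)
  next
    assume "x = y \<and> x \<in> carrier L \<and> covered_by L' x' y'"
    then show ?l
      using A.le_antisym[of _ x] by (auto simp: covered_by_def P.lless_eq B.lless_eq)
  qed
qed

text \<open>The lower covers of a pair are those of its two coordinates taken together. There is
  exactly one iff one coordinate has one and the other has none, that is, the other is the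
  bottom.\<close>

lemma join_irreducibles_prod:
  "join_irreducibles P =
     join_irreducibles L \<times> {\<bottom>\<^bsub>L'\<^esub>} \<union> {\<bottom>\<^bsub>L\<^esub>} \<times> join_irreducibles L'"
proof (rule Set.set_eqI)
  fix p :: "'a \<times> 'b"
  obtain x x' where p: "p = (x, x')" by fastforce
  show "p \<in> join_irreducibles P \<longleftrightarrow>
     p \<in> join_irreducibles L \<times> {\<bottom>\<^bsub>L'\<^esub>} \<union> {\<bottom>\<^bsub>L\<^esub>} \<times> join_irreducibles L'"
  proof (cases "x \<in> carrier L \<and> x' \<in> carrier L'")
    case True
    have "(\<exists>!p. covered_by P p (x, x')) \<longleftrightarrow>
       (\<exists>!y. covered_by L y x) \<and> (\<nexists>y'. covered_by L' y' x') \<or>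
       (\<nexists>y. covered_by L y x) \<and> (\<exists>!y'. covered_by L' y' x')"
      (is "?l \<longleftrightarrow> ?r")
    proof
      assume ?l
      then obtain p where "\<And>q. covered_by P q (x, x') \<longleftrightarrow> q = p"
        by metis
      moreover obtain z z' where "p = (z, z')"
        by fastforce
      ultimately have iff: "covered_by P (w, w') (x, x') \<longleftrightarrow> w = z \<and> w' = z'" for w w'
        by simp
      have "y = z \<and> x' = z'" if "covered_by L y x" for y
        using iff[of y x'] that True by (simp add: covered_by_prod)
      moreover have "x = z \<and> y' = z'" if "covered_by L' y' x'" for y'
        using iff[of x y'] that True by (simp add: covered_by_prod)
      \<comment> \<open>If both coordinates had lower covers \<open>y\<close> and \<open>y'\<close>,
        then \<open>y = z = x\<close>, and \<open>x\<close> would cover itself.\<close>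
      moreover have "\<not> covered_by L x x" "\<not> covered_by L' x' x'"
        by (auto simp: covered_by_def A.lless_eq B.lless_eq)
      ultimately show ?r
        using iff[of z z'] unfolding covered_by_prod by metis
    next
      assume ?r
      then show ?l
      proof (elim disjE conjE)
        assume y: "\<exists>!y. covered_by L y x" and none: "\<nexists>y'. covered_by L' y' x'"
        from y obtain y where "\<And>w. covered_by L w x \<longleftrightarrow> w = y"
          by metis
        with True none show ?l
          by (intro ex1I[of _ "(y, x')"]) (simp_all add: covered_by_prod split_paired_all)
      next
        assume y': "\<exists>!y'. covered_by L' y' x'" and none: "\<nexists>y. covered_by L y x"
        from y' obtain y' where "\<And>w. covered_by L' w x' \<longleftrightarrow> w = y'"
          by metis
        with True none show ?l
          by (intro ex1I[of _ "(x, y')"]) (simp_all add: covered_by_prod split_paired_all)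
      qed
    qed
    then show ?thesis
      using True A.no_lower_cover_iff[of x] B.no_lower_cover_iff[of x']
      by (simp add: p join_irreducibles_def conj_commute)
  qed (auto simp: p join_irreducibles_def)
qed

lemma lower_cover_prod:
  shows "j \<in> join_irreducibles L \<Longrightarrow> lower_cover P (j, \<bottom>\<^bsub>L'\<^esub>) = (lower_cover L j, \<bottom>\<^bsub>L'\<^esub>)"
    and "j' \<in> join_irreducibles L' \<Longrightarrow> lower_cover P (\<bottom>\<^bsub>L\<^esub>, j') = (\<bottom>\<^bsub>L\<^esub>, lower_cover L' j')"
  by (rule P.lower_cover_eq; simp add: join_irreducibles_prod covered_by_prod
      A.covered_by_lower_cover B.covered_by_lower_cover)+

lemma maximal_in_carrier: "maximal_in L (carrier L) = {\<top>\<^bsub>L\<^esub>}" "maximal_in L' (carrier L') = {\<top>\<^bsub>L'\<^esub>}"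
  by (auto simp: maximal_in_def intro: A.le_antisym B.le_antisym)

text \<open>In the bottom coordinate the equation reads
  \<open>\<bottom> = \<bottom> \<sqinter> z\<close>. Every \<open>z\<close> satisfies it, so the
  only maximal choice there is \<open>\<top>\<close>.\<close>

lemma meet_partners_prod:
  shows "j \<in> join_irreducibles L \<Longrightarrow> meet_partners P (j, \<bottom>\<^bsub>L'\<^esub>) = meet_partners L j \<times> {\<top>\<^bsub>L'\<^esub>}"
    and "j' \<in> join_irreducibles L' \<Longrightarrow> meet_partners P (\<bottom>\<^bsub>L\<^esub>, j') = {\<top>\<^bsub>L\<^esub>} \<times> meet_partners L' j'"
proof -
  have bot: "\<bottom>\<^bsub>L\<^esub> \<sqinter>\<^bsub>L\<^esub> z = \<bottom>\<^bsub>L\<^esub>" "\<bottom>\<^bsub>L'\<^esub> \<sqinter>\<^bsub>L'\<^esub> z' = \<bottom>\<^bsub>L'\<^esub>"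
    if "z \<in> carrier L" "z' \<in> carrier L'" for z z'
    using that A.bottom_meet B.bottom_meet by (auto simp: A.eq_is_equal B.eq_is_equal)
  note max = maximal_in_Times[OF A.fin_lat_axioms B.fin_lat_axioms]
  show "meet_partners P (j, \<bottom>\<^bsub>L'\<^esub>) = meet_partners L j \<times> {\<top>\<^bsub>L'\<^esub>}" if "j \<in> join_irreducibles L"
  proof -
    have "{z \<in> carrier P. lower_cover P (j, \<bottom>\<^bsub>L'\<^esub>) = (j, \<bottom>\<^bsub>L'\<^esub>) \<sqinter>\<^bsub>P\<^esub> z} =
      {z \<in> carrier L. lower_cover L j = j \<sqinter>\<^bsub>L\<^esub> z} \<times> carrier L'"
      using that by (auto simp: lower_cover_prod meet_prod A.join_irreducibles_closed bot)
    then show ?thesis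
      unfolding meet_partners_def by (simp add: max maximal_in_carrier)
  qed
  show "meet_partners P (\<bottom>\<^bsub>L\<^esub>, j') = {\<top>\<^bsub>L\<^esub>} \<times> meet_partners L' j'" if "j' \<in> join_irreducibles L'"
  proof -
    have "{z \<in> carrier P. lower_cover P (\<bottom>\<^bsub>L\<^esub>, j') = (\<bottom>\<^bsub>L\<^esub>, j') \<sqinter>\<^bsub>P\<^esub> z} =
      carrier L \<times> {z \<in> carrier L'. lower_cover L' j' = j' \<sqinter>\<^bsub>L'\<^esub> z}"
      using that by (auto simp: lower_cover_prod meet_prod B.join_irreducibles_closed bot)
    then show ?thesis
      unfolding meet_partners_def by (simp add: max maximal_in_carrier)
  qed
qed

lemma meet_irreducibles_prod:
  "meet_irreducibles P =
     meet_irreducibles L \<times> {\<top>\<^bsub>L'\<^esub>} \<union> {\<top>\<^bsub>L\<^esub>} \<times> meet_irreducibles L'"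
  using two_fin_lats.join_irreducibles_prod[OF two_fin_lats_dual]
  by (simp add: dual_prod_lattice[symmetric] P.join_irreducibles_dual A.join_irreducibles_dual
      B.join_irreducibles_dual del: eq_prod_lattice carrier_prod_lattice)

text \<open>This is \<open>meet_partners_prod\<close> for the reversed factors, where top and bottom
  trade places.\<close>

lemma join_partners_prod:
  shows "m \<in> meet_irreducibles L \<Longrightarrow> join_partners P (m, \<top>\<^bsub>L'\<^esub>) = join_partners L m \<times> {\<bottom>\<^bsub>L'\<^esub>}"
    and "m' \<in> meet_irreducibles L' \<Longrightarrow> join_partners P (\<top>\<^bsub>L\<^esub>, m') = {\<bottom>\<^bsub>L\<^esub>} \<times> join_partners L' m'"
proof -
  interpret D: two_fin_lats "inv_gorder L" "inv_gorder L'"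
    by (rule two_fin_lats_dual)
  note dual = dual_prod_lattice[symmetric] P.meet_partners_dual A.meet_partners_dual
    B.meet_partners_dual A.join_irreducibles_dual B.join_irreducibles_dual
  show "m \<in> meet_irreducibles L \<Longrightarrow> join_partners P (m, \<top>\<^bsub>L'\<^esub>) = join_partners L m \<times> {\<bottom>\<^bsub>L'\<^esub>}"
    using D.meet_partners_prod(1)[of m]
    by (simp add: dual del: eq_prod_lattice carrier_prod_lattice)
  show "m' \<in> meet_irreducibles L' \<Longrightarrow> join_partners P (\<top>\<^bsub>L\<^esub>, m') = {\<bottom>\<^bsub>L\<^esub>} \<times> join_partners L' m'"
    using D.meet_partners_prod(2)[of m']
    by (simp add: dual del: eq_prod_lattice carrier_prod_lattice)
qed

end

section \<open>Pairings of a product\<close>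

context two_fin_lats
begin

text \<open>The value \<open>undefined\<close> elsewhere makes the function extensional, as
  \<open>pairing\<close> demands. The first two cases never overlap, because the bottom is not
  join-irreducible.\<close>

definition prod_pairing :: "('a \<Rightarrow> 'a) \<Rightarrow> ('b \<Rightarrow> 'b) \<Rightarrow> 'a \<times> 'b \<Rightarrow> 'a \<times> 'b" where
  "prod_pairing k k' p =
     (if p \<in> join_irreducibles L \<times> {\<bottom>\<^bsub>L'\<^esub>} then (k (fst p), \<top>\<^bsub>L'\<^esub>)
      else if p \<in> {\<bottom>\<^bsub>L\<^esub>} \<times> join_irreducibles L' then (\<top>\<^bsub>L\<^esub>, k' (snd p))
      else undefined)"

lemma prod_pairing_simps:
  shows "j \<in> join_irreducibles L \<Longrightarrow> prod_pairing k k' (j, \<bottom>\<^bsub>L'\<^esub>) = (k j, \<top>\<^bsub>L'\<^esub>)"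
    and "j' \<in> join_irreducibles L' \<Longrightarrow> prod_pairing k k' (\<bottom>\<^bsub>L\<^esub>, j') = (\<top>\<^bsub>L\<^esub>, k' j')"
  using A.bottom_not_join_irreducible by (auto simp: prod_pairing_def)

lemma prod_pairing_extensional: "prod_pairing k k' \<in> extensional (join_irreducibles P)"
  by (auto simp: extensional_def prod_pairing_def join_irreducibles_prod)

lemma pairing_prod_pairing:
  assumes k: "pairing L k" and k': "pairing L' k'"
  shows "pairing P (prod_pairing k k')"
proof -
  have bij: "bij_betw k (join_irreducibles L) (meet_irreducibles L)"
    "bij_betw k' (join_irreducibles L') (meet_irreducibles L')"
    using assms by (simp_all add: pairing_def)
  have "bij_betw (prod_pairing k k') (join_irreducibles L \<times> {\<bottom>\<^bsub>L'\<^esub>}) (meet_irreducibles L \<times> {\<top>\<^bsub>L'\<^esub>})"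
    using bij(1) by (force simp: bij_betw_def inj_on_def prod_pairing_simps image_iff)
  moreover have "bij_betw (prod_pairing k k') ({\<bottom>\<^bsub>L\<^esub>} \<times> join_irreducibles L') ({\<top>\<^bsub>L\<^esub>} \<times> meet_irreducibles L')"
    using bij(2) by (force simp: bij_betw_def inj_on_def prod_pairing_simps image_iff)
  \<comment> \<open>The two bijections can be glued because their images are disjoint: a common
    element would make \<open>\<top>\<close> meet-irreducible.\<close>
  moreover have "(meet_irreducibles L \<times> {\<top>\<^bsub>L'\<^esub>}) \<inter> ({\<top>\<^bsub>L\<^esub>} \<times> meet_irreducibles L') = {}"
    using A.top_not_meet_irreducible by auto
  ultimately have "bij_betw (prod_pairing k k') (join_irreducibles P) (meet_irreducibles P)"
    unfolding join_irreducibles_prod meet_irreducibles_prod by (rule bij_betw_combine)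
  moreover have "prod_pairing k k' p \<in> meet_partners P p \<and> p \<in> join_partners P (prod_pairing k k' p)"
    if "p \<in> join_irreducibles P" for p
    using that k k' bij[THEN bij_betwE] unfolding join_irreducibles_prod
    by (auto simp: prod_pairing_simps meet_partners_prod join_partners_prod A.pairing_iff B.pairing_iff)
  ultimately show ?thesis
    unfolding P.pairing_iff using prod_pairing_extensional by simp
qed

text \<open>Partners of \<open>(j, \<bottom>)\<close> end in \<open>\<top>\<close> and partners of
  \<open>(\<bottom>, j')\<close> begin with \<open>\<top>\<close>. So every pairing of the product
  respects the two kinds of irreducibles and splits; this gives uniqueness.\<close>

lemma pairing_prodE:
  assumes K: "pairing P K"
  obtains k k' where "pairing L k" "pairing L' k'" "K = prod_pairing k k'"
proof -
  \<comment> \<open>The moving coordinates of \<open>K\<close> on the two kinds of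
    join-irreducibles; \<open>restrict\<close> makes them extensional.\<close>
  define k where "k = restrict (\<lambda>j. fst (K (j, \<bottom>\<^bsub>L'\<^esub>))) (join_irreducibles L)"
  define k' where "k' = restrict (\<lambda>j'. snd (K (\<bottom>\<^bsub>L\<^esub>, j'))) (join_irreducibles L')"
  have ext: "k \<in> extensional (join_irreducibles L)" "k' \<in> extensional (join_irreducibles L')"
    by (simp_all add: k_def k'_def)
  have K_ext: "K \<in> extensional (join_irreducibles P)"
    and inj: "inj_on K (join_irreducibles P)"
    and im: "K ` join_irreducibles P = meet_irreducibles P"
    and partner: "\<And>p. p \<in> join_irreducibles P \<Longrightarrow>
      K p \<in> meet_partners P p \<and> p \<in> join_partners P (K p) \<and> K p \<in> meet_irreducibles P"
    using K unfolding P.pairing_iff bij_betw_def by auto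
  have left: "K (j, \<bottom>\<^bsub>L'\<^esub>) = (k j, \<top>\<^bsub>L'\<^esub>) \<and> k j \<in> meet_irreducibles L \<and> k j \<in> meet_partners L j \<and>
      j \<in> join_partners L (k j)" if j: "j \<in> join_irreducibles L" for j
  proof -
    have mem: "K (j, \<bottom>\<^bsub>L'\<^esub>) \<in> meet_partners L j \<times> {\<top>\<^bsub>L'\<^esub>}"
      using partner[of "(j, \<bottom>\<^bsub>L'\<^esub>)"] j by (simp add: join_irreducibles_prod meet_partners_prod)
    then have eq: "K (j, \<bottom>\<^bsub>L'\<^esub>) = (k j, \<top>\<^bsub>L'\<^esub>)" and mp: "k j \<in> meet_partners L j"
      using j by (auto simp: k_def)
    \<comment> \<open>Otherwise the meet-irreducible \<open>(k j, \<top>)\<close> would be of the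
      second kind, with \<open>\<top>\<close> meet-irreducible in \<open>L'\<close>.\<close>
    have "k j \<in> meet_irreducibles L"
      using partner[of "(j, \<bottom>\<^bsub>L'\<^esub>)"] j B.top_not_meet_irreducible
      by (simp add: eq join_irreducibles_prod meet_irreducibles_prod)
    moreover from this have "j \<in> join_partners L (k j)"
      using partner[of "(j, \<bottom>\<^bsub>L'\<^esub>)"] j by (simp add: eq join_irreducibles_prod join_partners_prod)
    ultimately show ?thesis using eq mp by simp
  qed
  have right: "K (\<bottom>\<^bsub>L\<^esub>, j') = (\<top>\<^bsub>L\<^esub>, k' j') \<and> k' j' \<in> meet_irreducibles L' \<and> k' j' \<in> meet_partners L' j' \<and>
      j' \<in> join_partners L' (k' j')" if j': "j' \<in> join_irreducibles L'" for j'
  proof -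
    have mem: "K (\<bottom>\<^bsub>L\<^esub>, j') \<in> {\<top>\<^bsub>L\<^esub>} \<times> meet_partners L' j'"
      using partner[of "(\<bottom>\<^bsub>L\<^esub>, j')"] j' by (simp add: join_irreducibles_prod meet_partners_prod)
    then have eq: "K (\<bottom>\<^bsub>L\<^esub>, j') = (\<top>\<^bsub>L\<^esub>, k' j')" and mp: "k' j' \<in> meet_partners L' j'"
      using j' by (auto simp: k'_def)
    have "k' j' \<in> meet_irreducibles L'"
      using partner[of "(\<bottom>\<^bsub>L\<^esub>, j')"] j' A.top_not_meet_irreducible
      by (simp add: eq join_irreducibles_prod meet_irreducibles_prod)
    moreover from this have "j' \<in> join_partners L' (k' j')"
      using partner[of "(\<bottom>\<^bsub>L\<^esub>, j')"] j' by (simp add: eq join_irreducibles_prod join_partners_prod)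
    ultimately show ?thesis using eq mp by simp
  qed
  have "inj_on k (join_irreducibles L)"
  proof (rule inj_onI)
    fix i j assume "i \<in> join_irreducibles L" "j \<in> join_irreducibles L" "k i = k j"
    then show "i = j"
      using inj_onD[OF inj, of "(i, \<bottom>\<^bsub>L'\<^esub>)" "(j, \<bottom>\<^bsub>L'\<^esub>)"] left by (simp add: join_irreducibles_prod)
  qed
  moreover have "inj_on k' (join_irreducibles L')"
  proof (rule inj_onI)
    fix i j assume "i \<in> join_irreducibles L'" "j \<in> join_irreducibles L'" "k' i = k' j"
    then show "i = j"
      using inj_onD[OF inj, of "(\<bottom>\<^bsub>L\<^esub>, i)" "(\<bottom>\<^bsub>L\<^esub>, j)"] right by (simp add: join_irreducibles_prod)
  qed
  \<comment> \<open>A preimage of \<open>(m, \<top>)\<close> cannot be some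
    \<open>(\<bottom>, j')\<close>: its value would begin with \<open>\<top>\<close>, whereas
    \<open>m\<close> is meet-irreducible and so differs from \<open>\<top>\<close>.\<close>
  moreover have "m \<in> k ` join_irreducibles L" if m: "m \<in> meet_irreducibles L" for m
  proof -
    have "(m, \<top>\<^bsub>L'\<^esub>) \<in> K ` join_irreducibles P"
      using m by (simp add: im meet_irreducibles_prod)
    then obtain p where p: "p \<in> join_irreducibles P" "K p = (m, \<top>\<^bsub>L'\<^esub>)"
      by auto
    then show ?thesis
      using left right m A.top_not_meet_irreducible by (auto simp: join_irreducibles_prod)
  qed
  moreover have "m' \<in> k' ` join_irreducibles L'" if m': "m' \<in> meet_irreducibles L'" for m'
  proof -
    have "(\<top>\<^bsub>L\<^esub>, m') \<in> K ` join_irreducibles P"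
      using m' by (simp add: im meet_irreducibles_prod)
    then obtain p where p: "p \<in> join_irreducibles P" "K p = (\<top>\<^bsub>L\<^esub>, m')"
      by auto
    then show ?thesis
      using left right m' B.top_not_meet_irreducible by (auto simp: join_irreducibles_prod)
  qed
  ultimately have "pairing L k" "pairing L' k'"
    using left right unfolding A.pairing_iff B.pairing_iff
    by (auto simp: bij_betw_def ext)
  moreover have "K = prod_pairing k k'"
  proof (rule extensionalityI[OF K_ext prod_pairing_extensional])
    fix p assume "p \<in> join_irreducibles P"
    then show "K p = prod_pairing k k' p"
      using left right by (auto simp: join_irreducibles_prod prod_pairing_simps)
  qed
  ultimately show thesis by (rule that)
qed

end

locale two_uniquely_paired =
  fixes L :: "'a gorder" and L' :: "'b gorder"
  assumes up: "uniquely_paired L" and up': "uniquely_paired L'"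

sublocale two_uniquely_paired \<subseteq> two_fin_lats
  using up up' by (simp add: two_fin_lats_def fin_lat_if_uniquely_paired)

context two_uniquely_paired
begin

text \<open>Any pairing splits by \<open>pairing_prodE\<close>, and its two parts are determined by
  the unique pairings of the factors.\<close>

lemma uniquely_paired_prod: "uniquely_paired P"
proof -
  have "pairing P (prod_pairing (kappa L) (kappa L'))"
    by (intro pairing_prod_pairing pairing_kappa up up')
  moreover have "K = prod_pairing (kappa L) (kappa L')" if "pairing P K" for K
    using that by (rule pairing_prodE) (simp add: kappa_eq[OF up] kappa_eq[OF up'])
  ultimately show ?thesis
    using P.fin_lat_axioms unfolding uniquely_paired_def fin_lat_iff by metis
qed

lemma kappa_prod:
  shows "j \<in> join_irreducibles L \<Longrightarrow> kappa P (j, \<bottom>\<^bsub>L'\<^esub>) = (kappa L j, \<top>\<^bsub>L'\<^esub>)"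
    and "j' \<in> join_irreducibles L' \<Longrightarrow> kappa P (\<bottom>\<^bsub>L\<^esub>, j') = (\<top>\<^bsub>L\<^esub>, kappa L' j')"
  using kappa_eq[OF uniquely_paired_prod pairing_prod_pairing[OF pairing_kappa[OF up] pairing_kappa[OF up']]]
  by (simp_all add: prod_pairing_simps)

lemma kappa_inv_prod:
  shows "m \<in> meet_irreducibles L \<Longrightarrow> kappa_inv P (m, \<top>\<^bsub>L'\<^esub>) = (kappa_inv L m, \<bottom>\<^bsub>L'\<^esub>)"
    and "m' \<in> meet_irreducibles L' \<Longrightarrow> kappa_inv P (\<top>\<^bsub>L\<^esub>, m') = (\<bottom>\<^bsub>L\<^esub>, kappa_inv L' m')"
  using kappa_inv_kappa[OF uniquely_paired_prod, of "(kappa_inv L m, \<bottom>\<^bsub>L'\<^esub>)"]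
    kappa_inv_kappa[OF uniquely_paired_prod, of "(\<bottom>\<^bsub>L\<^esub>, kappa_inv L' m')"]
  by (simp_all add: join_irreducibles_prod kappa_prod kappa_inv_mem kappa_kappa_inv up up')

end

section \<open>Dismantling a product\<close>

lemma carrier_interval [simp]:
  "carrier (interval L a b) = {x \<in> carrier L. a \<sqsubseteq>\<^bsub>L\<^esub> x \<and> x \<sqsubseteq>\<^bsub>L\<^esub> b}"
  by (simp add: interval_def at_least_at_most_def)

lemma le_interval [simp]: "x \<sqsubseteq>\<^bsub>interval L a b\<^esub> y \<longleftrightarrow> x \<sqsubseteq>\<^bsub>L\<^esub> y"
  by (simp add: interval_def)

lemma interval_prod:
  "interval (prod_lattice L L') (a, a') (b, b') = prod_lattice (interval L a b) (interval L' a' b')"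
  by (auto simp: prod_lattice_def interval_def at_least_at_most_def)

context fin_lat
begin

lemma interval_bottom_top: "interval L \<bottom> \<top> = L"
proof -
  have "\<lbrace>\<bottom>..\<top>\<rbrace> = carrier L"
    by (auto simp: at_least_at_most_def)
  then show ?thesis by (simp add: interval_def)
qed

lemma bottom_interval:
  assumes "fin_lat (interval L a b)" "a \<in> carrier L" "a \<sqsubseteq> b"
  shows "\<bottom>\<^bsub>interval L a b\<^esub> = a"
proof -
  interpret I: fin_lat "interval L a b" by fact
  show ?thesis using assms by (intro I.bottom_eq[symmetric]) auto
qed

lemma top_interval:
  assumes "fin_lat (interval L a b)" "b \<in> carrier L" "a \<sqsubseteq> b"
  shows "\<top>\<^bsub>interval L a b\<^esub> = b"
proof -
  interpret I: fin_lat "interval L a b" by fact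
  show ?thesis using assms by (intro I.top_eq[symmetric]) auto
qed

text \<open>The bounds serve as trivial cut points, so that dismantling \<open>L\<close> or \<open>L'\<close> inside the product
  is an instance of cutting both factors.\<close>

lemma compatible_above_bottom:
  assumes "uniquely_paired L" shows "compatible_above L \<bottom>"
proof -
  have "{j \<in> join_irreducibles L. \<bottom> \<sqsubseteq> kappa L j} = join_irreducibles L"
    using kappa_closed[OF assms] by auto
  moreover have "\<bottom> \<squnion> j = j" if "j \<in> join_irreducibles L" for j
    using bottom_join[of j] that by (simp add: join_irreducibles_closed eq_is_equal)
  ultimately show ?thesis
    by (simp add: compatible_above_def Let_def interval_bottom_top bij_betw_def inj_on_def)
qed

lemma compatible_below_top:
  assumes "uniquely_paired L" shows "compatible_below L \<top>"
proof -
  have "{m \<in> meet_irreducibles L. kappa_inv L m \<sqsubseteq> \<top>} = meet_irreducibles L"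
    using kappa_inv_mem[OF assms] join_irreducibles_closed by auto
  moreover have "\<top> \<sqinter> m = m" if "m \<in> meet_irreducibles L" for m
    using top_meet[of m] that by (simp add: meet_irreducibles_closed eq_is_equal)
  ultimately show ?thesis
    by (simp add: compatible_below_def Let_def interval_bottom_top bij_betw_def inj_on_def)
qed

end

context two_fin_lats
begin

text \<open>The coordinate cut at a bound imposes no condition, so the side on which a pair lies is
  decided by the other coordinate.\<close>

lemma prime_pair_prod:
  shows "prime_pair L j m \<Longrightarrow> prime_pair P (j, \<bottom>\<^bsub>L'\<^esub>) (m, \<top>\<^bsub>L'\<^esub>)"
    and "prime_pair L' j' m' \<Longrightarrow> prime_pair P (\<bottom>\<^bsub>L\<^esub>, j') (\<top>\<^bsub>L\<^esub>, m')"
  by (auto simp: prime_pair_def at_least_at_most_def bottom_prod top_prod set_eq_iff)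

end

section \<open>Cutting both factors at once\<close>

context two_uniquely_paired
begin

text \<open>The upper interval is \<open>U \<times> U'\<close>, whose join-irreducibles again come
  in two kinds; on each kind the join with \<open>(a, a')\<close> acts as the given bijection of one
  factor.\<close>

lemma compatible_above_prod:
  assumes a: "a \<in> carrier L" "compatible_above L a" "uniquely_paired (interval L a \<top>\<^bsub>L\<^esub>)"
    and a': "a' \<in> carrier L'" "compatible_above L' a'" "uniquely_paired (interval L' a' \<top>\<^bsub>L'\<^esub>)"
  shows "compatible_above P (a, a')"
proof -
  define U where "U = interval L a \<top>\<^bsub>L\<^esub>"
  define U' where "U' = interval L' a' \<top>\<^bsub>L'\<^esub>"
  define A where "A = {j \<in> join_irreducibles L. a \<sqsubseteq>\<^bsub>L\<^esub> kappa L j}"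
  define A' where "A' = {j \<in> join_irreducibles L'. a' \<sqsubseteq>\<^bsub>L'\<^esub> kappa L' j}"
  define f where "f = (\<lambda>p. (a, a') \<squnion>\<^bsub>P\<^esub> p)"
  interpret U: two_uniquely_paired U U'
    using a a' by (simp add: two_uniquely_paired_def U_def U'_def)
  have bots: "\<bottom>\<^bsub>U\<^esub> = a" "\<bottom>\<^bsub>U'\<^esub> = a'"
    using A.bottom_interval B.bottom_interval U.A.fin_lat_axioms U.B.fin_lat_axioms a a'
    by (auto simp: U_def U'_def)
  have tops: "\<top>\<^bsub>U\<^esub> = \<top>\<^bsub>L\<^esub>" "\<top>\<^bsub>U'\<^esub> = \<top>\<^bsub>L'\<^esub>"
    using A.top_interval B.top_interval U.A.fin_lat_axioms U.B.fin_lat_axioms a a'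
    by (auto simp: U_def U'_def)
  have bij: "bij_betw (\<lambda>j. a \<squnion>\<^bsub>L\<^esub> j) A (join_irreducibles U)"
      "bij_betw (\<lambda>j. a' \<squnion>\<^bsub>L'\<^esub> j) A' (join_irreducibles U')"
    and kappa: "\<And>j. j \<in> A \<Longrightarrow> kappa U (a \<squnion>\<^bsub>L\<^esub> j) = kappa L j"
      "\<And>j. j \<in> A' \<Longrightarrow> kappa U' (a' \<squnion>\<^bsub>L'\<^esub> j) = kappa L' j"
    using a a' by (simp_all add: compatible_above_def Let_def U_def U'_def A_def A'_def)
  \<comment> \<open>Joining with \<open>(a, a')\<close> turns the bottom of the idle factor into the
    bottom of its interval, as \<open>U.join_irreducibles_prod\<close> requires.\<close>
  have bot: "a \<squnion>\<^bsub>L\<^esub> \<bottom>\<^bsub>L\<^esub> = a" "a' \<squnion>\<^bsub>L'\<^esub> \<bottom>\<^bsub>L'\<^esub> = a'"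
    using A.bottom_join B.bottom_join a a'
    by (simp_all add: A.eq_is_equal B.eq_is_equal join_comm[of _ _ "\<bottom>\<^bsub>_\<^esub>"])
  have f: "f (j, \<bottom>\<^bsub>L'\<^esub>) = (a \<squnion>\<^bsub>L\<^esub> j, a')" if "j \<in> A" for j
    using that a a' by (simp add: f_def join_prod bot A_def A.join_irreducibles_closed)
  have f': "f (\<bottom>\<^bsub>L\<^esub>, j) = (a, a' \<squnion>\<^bsub>L'\<^esub> j)" if "j \<in> A'" for j
    using that a a' by (simp add: f_def join_prod bot A'_def B.join_irreducibles_closed)
  \<comment> \<open>\<open>kappa P\<close> has \<open>\<top>\<close> in the idle coordinate, so the
    condition there holds automatically.\<close>
  have *: "{p \<in> join_irreducibles P. (a, a') \<sqsubseteq>\<^bsub>P\<^esub> kappa P p} = A \<times> {\<bottom>\<^bsub>L'\<^esub>} \<union> {\<bottom>\<^bsub>L\<^esub>} \<times> A'"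
    using a a' by (auto simp: join_irreducibles_prod A_def A'_def kappa_prod)
  have "bij_betw f (A \<times> {\<bottom>\<^bsub>L'\<^esub>}) (join_irreducibles U \<times> {a'})"
    using bij(1) by (force simp: bij_betw_def inj_on_def f image_iff)
  moreover have "bij_betw f ({\<bottom>\<^bsub>L\<^esub>} \<times> A') ({a} \<times> join_irreducibles U')"
    using bij(2) by (force simp: bij_betw_def inj_on_def f' image_iff)
  \<comment> \<open>A common element would make \<open>a\<close>, the bottom of \<open>U\<close>,
    join-irreducible.\<close>
  moreover have "(join_irreducibles U \<times> {a'}) \<inter> ({a} \<times> join_irreducibles U') = {}"
    using U.A.bottom_not_join_irreducible by (auto simp: bots)
  ultimately have "bij_betw f (A \<times> {\<bottom>\<^bsub>L'\<^esub>} \<union> {\<bottom>\<^bsub>L\<^esub>} \<times> A') (join_irreducibles U.P)"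
    unfolding U.join_irreducibles_prod bots by (rule bij_betw_combine)
  moreover have "kappa U.P (f p) = kappa P p" if "p \<in> A \<times> {\<bottom>\<^bsub>L'\<^esub>} \<union> {\<bottom>\<^bsub>L\<^esub>} \<times> A'" for p
    using that
  proof
    assume "p \<in> A \<times> {\<bottom>\<^bsub>L'\<^esub>}"
    then obtain j where j: "j \<in> A" "p = (j, \<bottom>\<^bsub>L'\<^esub>)"
      by auto
    then show ?thesis
      using U.kappa_prod(1)[of "a \<squnion>\<^bsub>L\<^esub> j"] bij_betwE[OF bij(1)] kappa kappa_prod(1)
      by (simp add: f bots tops A_def)
  next
    assume "p \<in> {\<bottom>\<^bsub>L\<^esub>} \<times> A'"
    then obtain j where j: "j \<in> A'" "p = (\<bottom>\<^bsub>L\<^esub>, j)"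
      by auto
    then show ?thesis
      using U.kappa_prod(2)[of "a' \<squnion>\<^bsub>L'\<^esub> j"] bij_betwE[OF bij(2)] kappa kappa_prod(2)
      by (simp add: f' bots tops A'_def)
  qed
  ultimately show ?thesis
    unfolding compatible_above_def Let_def * top_prod interval_prod f_def U_def U'_def by simp
qed

text \<open>The mirror image of \<open>compatible_above_prod\<close>: \<open>kappa_inv\<close>
  replaces \<open>kappa\<close>, and \<open>b\<close>, \<open>b'\<close> are the tops of the lower
  intervals.\<close>

lemma compatible_below_prod:
  assumes b: "b \<in> carrier L" "compatible_below L b" "uniquely_paired (interval L \<bottom>\<^bsub>L\<^esub> b)"
    and b': "b' \<in> carrier L'" "compatible_below L' b'" "uniquely_paired (interval L' \<bottom>\<^bsub>L'\<^esub> b')"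
  shows "compatible_below P (b, b')"
proof -
  define D where "D = interval L \<bottom>\<^bsub>L\<^esub> b"
  define D' where "D' = interval L' \<bottom>\<^bsub>L'\<^esub> b'"
  define B where "B = {m \<in> meet_irreducibles L. kappa_inv L m \<sqsubseteq>\<^bsub>L\<^esub> b}"
  define B' where "B' = {m \<in> meet_irreducibles L'. kappa_inv L' m \<sqsubseteq>\<^bsub>L'\<^esub> b'}"
  define f where "f = (\<lambda>p. (b, b') \<sqinter>\<^bsub>P\<^esub> p)"
  interpret D: two_uniquely_paired D D'
    using b b' by (simp add: two_uniquely_paired_def D_def D'_def)
  have bots: "\<bottom>\<^bsub>D\<^esub> = \<bottom>\<^bsub>L\<^esub>" "\<bottom>\<^bsub>D'\<^esub> = \<bottom>\<^bsub>L'\<^esub>"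
    using A.bottom_interval B.bottom_interval D.A.fin_lat_axioms D.B.fin_lat_axioms b b'
    by (auto simp: D_def D'_def)
  have tops: "\<top>\<^bsub>D\<^esub> = b" "\<top>\<^bsub>D'\<^esub> = b'"
    using A.top_interval B.top_interval D.A.fin_lat_axioms D.B.fin_lat_axioms b b'
    by (auto simp: D_def D'_def)
  have bij: "bij_betw (\<lambda>m. b \<sqinter>\<^bsub>L\<^esub> m) B (meet_irreducibles D)"
      "bij_betw (\<lambda>m. b' \<sqinter>\<^bsub>L'\<^esub> m) B' (meet_irreducibles D')"
    and kappa_inv: "\<And>m. m \<in> B \<Longrightarrow> kappa_inv D (b \<sqinter>\<^bsub>L\<^esub> m) = kappa_inv L m"
      "\<And>m. m \<in> B' \<Longrightarrow> kappa_inv D' (b' \<sqinter>\<^bsub>L'\<^esub> m) = kappa_inv L' m"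
    using b b' by (simp_all add: compatible_below_def Let_def D_def D'_def B_def B'_def)
  have top: "b \<sqinter>\<^bsub>L\<^esub> \<top>\<^bsub>L\<^esub> = b" "b' \<sqinter>\<^bsub>L'\<^esub> \<top>\<^bsub>L'\<^esub> = b'"
    using A.top_meet B.top_meet b b'
    by (simp_all add: A.eq_is_equal B.eq_is_equal meet_comm[of _ _ "\<top>\<^bsub>_\<^esub>"])
  have f: "f (m, \<top>\<^bsub>L'\<^esub>) = (b \<sqinter>\<^bsub>L\<^esub> m, b')" if "m \<in> B" for m
    using that b b' by (simp add: f_def meet_prod top B_def A.meet_irreducibles_closed)
  have f': "f (\<top>\<^bsub>L\<^esub>, m) = (b, b' \<sqinter>\<^bsub>L'\<^esub> m)" if "m \<in> B'" for m
    using that b b' by (simp add: f_def meet_prod top B'_def B.meet_irreducibles_closed)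
  have *: "{p \<in> meet_irreducibles P. kappa_inv P p \<sqsubseteq>\<^bsub>P\<^esub> (b, b')} = B \<times> {\<top>\<^bsub>L'\<^esub>} \<union> {\<top>\<^bsub>L\<^esub>} \<times> B'"
    using b b' by (auto simp: meet_irreducibles_prod B_def B'_def kappa_inv_prod)
  have "bij_betw f (B \<times> {\<top>\<^bsub>L'\<^esub>}) (meet_irreducibles D \<times> {b'})"
    using bij(1) by (force simp: bij_betw_def inj_on_def f image_iff)
  moreover have "bij_betw f ({\<top>\<^bsub>L\<^esub>} \<times> B') ({b} \<times> meet_irreducibles D')"
    using bij(2) by (force simp: bij_betw_def inj_on_def f' image_iff)
  moreover have "(meet_irreducibles D \<times> {b'}) \<inter> ({b} \<times> meet_irreducibles D') = {}"
    using D.A.top_not_meet_irreducible by (auto simp: tops)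
  ultimately have "bij_betw f (B \<times> {\<top>\<^bsub>L'\<^esub>} \<union> {\<top>\<^bsub>L\<^esub>} \<times> B') (meet_irreducibles D.P)"
    unfolding D.meet_irreducibles_prod tops by (rule bij_betw_combine)
  moreover have "kappa_inv D.P (f p) = kappa_inv P p" if "p \<in> B \<times> {\<top>\<^bsub>L'\<^esub>} \<union> {\<top>\<^bsub>L\<^esub>} \<times> B'" for p
    using that
  proof
    assume "p \<in> B \<times> {\<top>\<^bsub>L'\<^esub>}"
    then obtain m where m: "m \<in> B" "p = (m, \<top>\<^bsub>L'\<^esub>)"
      by auto
    then show ?thesis
      using D.kappa_inv_prod(1)[of "b \<sqinter>\<^bsub>L\<^esub> m"] bij_betwE[OF bij(1)] kappa_inv kappa_inv_prod(1)
      by (simp add: f bots tops B_def)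
  next
    assume "p \<in> {\<top>\<^bsub>L\<^esub>} \<times> B'"
    then obtain m where m: "m \<in> B'" "p = (\<top>\<^bsub>L\<^esub>, m)"
      by auto
    then show ?thesis
      using D.kappa_inv_prod(2)[of "b' \<sqinter>\<^bsub>L'\<^esub> m"] bij_betwE[OF bij(2)] kappa_inv kappa_inv_prod(2)
      by (simp add: f' bots tops B'_def)
  qed
  ultimately show ?thesis
    unfolding compatible_below_def Let_def * bottom_prod interval_prod f_def D_def D'_def by simp
qed

end

lemma uniquely_paired_if_compatibly_dismantlable:
  "compatibly_dismantlable L \<Longrightarrow> uniquely_paired L"
  by (auto elim: compatibly_dismantlable.cases)

text \<open>The outer induction dismantles \<open>L\<close> while \<open>L'\<close> stays whole;
  once \<open>L\<close> is a single point, the inner induction dismantles \<open>L'\<close>.\<close>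

lemma compatibly_dismantlable_prod:
  fixes L :: "'a gorder" and L' :: "'b gorder"
  assumes "compatibly_dismantlable L" "compatibly_dismantlable L'"
  shows "compatibly_dismantlable (prod_lattice L L')"
  using assms
proof (induction L arbitrary: L' rule: compatibly_dismantlable.induct)
  case (trivial L)
  show ?case
    using \<open>compatibly_dismantlable L'\<close>
  proof (induction L' rule: compatibly_dismantlable.induct)
    case (trivial L')
    interpret two_uniquely_paired L L'
      using \<open>uniquely_paired L\<close> \<open>uniquely_paired L'\<close> by unfold_locales
    show ?case
      using \<open>card (carrier L) = 1\<close> \<open>card (carrier L') = 1\<close>
      by (intro compatibly_dismantlable.trivial uniquely_paired_prod) (simp add: card_cartesian_product)
  next
    case (dismantle L' j m)
    interpret two_uniquely_paired L L'
      using \<open>uniquely_paired L\<close> \<open>uniquely_paired L'\<close> by unfold_locales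
    have mem: "j \<in> carrier L'" "m \<in> carrier L'"
      using dismantle by (auto simp: prime_pair_def)
    note ups = dismantle.hyps(3,5)[THEN uniquely_paired_if_compatibly_dismantlable]
    \<comment> \<open>Here \<open>L\<close> is cut at its bounds and reappears as its own interval
      from \<open>\<bottom>\<close> to \<open>\<top>\<close>.\<close>
    show ?case
      using dismantle mem ups up
      by (intro compatibly_dismantlable.dismantle[OF uniquely_paired_prod prime_pair_prod(2)]
          compatible_above_prod compatible_below_prod)
        (simp_all add: top_prod bottom_prod interval_prod A.interval_bottom_top
          A.compatible_above_bottom A.compatible_below_top)
  qed
next
  case (dismantle L j m)
  interpret two_uniquely_paired L L'
    using dismantle by unfold_locales (simp_all add: uniquely_paired_if_compatibly_dismantlable)
  have mem: "j \<in> carrier L" "m \<in> carrier L"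
    using dismantle by (auto simp: prime_pair_def)
  note ups = dismantle.hyps(3,5)[THEN uniquely_paired_if_compatibly_dismantlable]
  show ?case
    using dismantle mem ups up'
    by (intro compatibly_dismantlable.dismantle[OF uniquely_paired_prod prime_pair_prod(1)]
        compatible_above_prod compatible_below_prod)
      (simp_all add: top_prod bottom_prod interval_prod B.interval_bottom_top
        B.compatible_above_bottom B.compatible_below_top)
qed

section \<open>Labels of covers\<close>

lemma (in fin_lat) covered_by_interval:
  assumes "covered_by L x y" "a \<sqsubseteq> x" "y \<sqsubseteq> b" "a \<in> carrier L" "b \<in> carrier L"
  shows "covered_by (interval L a b) x y"
proof -
  have "x \<in> carrier L" "y \<in> carrier L" "x \<sqsubseteq> y"
    using assms(1) by (auto simp: covered_by_def lless_eq)
  moreover from this have "a \<sqsubseteq> y" "x \<sqsubseteq> b"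
    using assms le_trans[of a x y] le_trans[of x y b] by simp_all
  ultimately show ?thesis
    using assms by (auto simp: covered_by_def lless_def interval_def at_least_at_most_def)
qed

section \<open>Covers relative to a prime pair\<close>

locale prime_paired = fin_lat L for L :: "'a gorder" (structure) +
  fixes j0 m0
  assumes up: "uniquely_paired L" and prime: "prime_pair L j0 m0"
begin

lemma j0_closed: "j0 \<in> carrier L" and m0_closed: "m0 \<in> carrier L"
  using prime unfolding prime_pair_def by blast+

lemma le_m0_iff:
  assumes "z \<in> carrier L" shows "z \<sqsubseteq> m0 \<longleftrightarrow> \<not> j0 \<sqsubseteq> z"
  using assms prime by (auto simp: prime_pair_def at_least_at_most_def set_eq_iff)

text \<open>Whatever is strictly below \<open>j0\<close> is not above \<open>j0\<close>, hence is
  below \<open>m0\<close>. So \<open>j0 \<sqinter> m0\<close> is the greatest element strictly below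
  \<open>j0\<close>.\<close>

lemma covered_by_j0_iff: "covered_by L v j0 \<longleftrightarrow> v = j0 \<sqinter> m0"
proof -
  let ?w = "j0 \<sqinter> m0"
  have w: "?w \<in> carrier L" "?w \<sqsubseteq> j0" "?w \<sqsubseteq> m0"
    using j0_closed m0_closed by (simp_all add: meet_left meet_right)
  then have "?w \<noteq> j0"
    using le_m0_iff[OF j0_closed] j0_closed by auto
  have le_w: "z \<sqsubseteq> ?w" if "z \<in> carrier L" "z \<sqsubseteq> j0" "z \<noteq> j0" for z
    using that le_m0_iff[of z] le_antisym[of z j0] j0_closed m0_closed by (auto intro: meet_le)
  have "covered_by L ?w j0"
    using w \<open>?w \<noteq> j0\<close> le_w j0_closed le_antisym[of _ ?w] by (auto simp: covered_by_def lless_eq)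
  moreover have "v = ?w" if "covered_by L v j0"
    using that w \<open>?w \<noteq> j0\<close> le_w[of v] by (auto simp: covered_by_def lless_eq)
  ultimately show ?thesis by auto
qed

lemma j0_join_irreducible: "j0 \<in> join_irreducibles L"
  using j0_closed by (simp add: join_irreducibles_def covered_by_j0_iff)

text \<open>\<open>kappa L j0\<close> is not above \<open>j0\<close>, hence is below
  \<open>m0\<close>; but \<open>m0\<close> also meets \<open>j0\<close> in its lower cover, so
  maximality forces equality.\<close>

lemma kappa_j0: "kappa L j0 = m0"
proof -
  have k: "kappa L j0 \<in> meet_partners L j0" "kappa L j0 \<in> carrier L" "\<not> j0 \<sqsubseteq> kappa L j0"
    using j0_join_irreducible up by (simp_all add: kappa_meet_partner kappa_closed not_le_kappa)
  then have "kappa L j0 \<sqsubseteq> m0"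
    by (simp add: le_m0_iff)
  moreover have "lower_cover L j0 = j0 \<sqinter> m0"
    by (rule lower_cover_eq) (simp_all add: j0_join_irreducible covered_by_j0_iff)
  then have "m0 \<in> {z \<in> carrier L. lower_cover L j0 = j0 \<sqinter> z}"
    using m0_closed by simp
  ultimately show ?thesis
    using k(1) unfolding meet_partners_def maximal_in_def by blast
qed

text \<open>The bijection \<open>j \<mapsto> j0 \<squnion> j\<close> preserves \<open>kappa\<close>
  and, because \<open>j0 \<sqsubseteq> y\<close>, also preserves being below \<open>y\<close>. It
  therefore carries the labels in \<open>L\<close> to those in the upper interval.\<close>

lemma label_above:
  assumes cov: "covered_by L x y" and "j0 \<sqsubseteq> x" and ab: "compatible_above L j0"
    and ex1: "\<exists>!i. i \<in> M_set (interval L j0 \<top>) x \<inter> J_set (interval L j0 \<top>) y"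
  shows "\<exists>!j. j \<in> M_set L x \<inter> J_set L y"
proof -
  define U where "U = interval L j0 \<top>"
  define A where "A = {j \<in> join_irreducibles L. j0 \<sqsubseteq> kappa L j}"
  have xy: "x \<in> carrier L" "y \<in> carrier L" "x \<sqsubseteq> y"
    using cov by (auto simp: covered_by_def lless_eq)
  have j0y: "j0 \<sqsubseteq> y"
    using le_trans[of j0 x y] xy j0_closed \<open>j0 \<sqsubseteq> x\<close> by simp
  have bij: "bij_betw (\<lambda>j. j0 \<squnion> j) A (join_irreducibles U)"
    and kap: "\<And>j. j \<in> A \<Longrightarrow> kappa U (j0 \<squnion> j) = kappa L j"
    using ab by (simp_all add: compatible_above_def Let_def U_def A_def)
  have closed: "j \<in> carrier L" if "j \<in> A" for j
    using that by (simp add: A_def join_irreducibles_closed)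
  have join_iff: "j0 \<squnion> j \<sqsubseteq> y \<longleftrightarrow> j \<sqsubseteq> y" if "j \<in> A" for j
    using le_trans[of j "j0 \<squnion> j" y] join_right[of j0 j] join_le[of j0 y j] closed[OF that]
      xy j0_closed j0y by auto
  have transfer: "j \<in> M_set L x \<inter> J_set L y \<longleftrightarrow> j \<in> A \<and> j0 \<squnion> j \<in> M_set U x \<inter> J_set U y" for j
  proof -
    \<comment> \<open>Every label takes part in the bijection, since
      \<open>j0 \<sqsubseteq> x \<sqsubseteq> kappa L j\<close>.\<close>
    have "j \<in> A" if "j \<in> M_set L x"
      using that le_trans[of j0 x "kappa L j"] xy j0_closed \<open>j0 \<sqsubseteq> x\<close> kappa_closed[OF up]
      by (auto simp: M_set_def A_def)
    moreover have "?thesis" if "j \<in> A"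
      using that bij_betwE[OF bij] kap[OF that] join_iff[OF that]
      by (auto simp: M_set_def J_set_def A_def U_def)
    ultimately show ?thesis by auto
  qed
  obtain i where i: "i \<in> M_set U x \<inter> J_set U y"
    and i_uniq: "\<And>i'. i' \<in> M_set U x \<inter> J_set U y \<Longrightarrow> i' = i"
    using ex1 unfolding U_def by metis
  have "i \<in> join_irreducibles U"
    using i by (simp add: M_set_def)
  then have "i \<in> (\<lambda>j. j0 \<squnion> j) ` A"
    using bij_betw_imp_surj_on[OF bij] by simp
  then obtain j where j: "j \<in> A" "j0 \<squnion> j = i"
    by auto
  show ?thesis
  proof (rule ex1I)
    show "j \<in> M_set L x \<inter> J_set L y"
      using i j transfer[of j] by simp
  next
    fix j' assume "j' \<in> M_set L x \<inter> J_set L y"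
    then have j': "j' \<in> A" "j0 \<squnion> j' \<in> M_set U x \<inter> J_set U y"
      using transfer[of j'] by simp_all
    then have "j0 \<squnion> j' = j0 \<squnion> j"
      using i_uniq j by metis
    then show "j' = j"
      using inj_onD[OF bij_betw_imp_inj_on[OF bij]] j j' by metis
  qed
qed

text \<open>Below \<open>m0\<close> only the meet-irreducible is changed, to
  \<open>m0 \<sqinter> m\<close>, while its partner \<open>kappa_inv L m\<close> stays the same. So
  the two label sets coincide.\<close>

lemma label_below:
  assumes cov: "covered_by L x y" and "y \<sqsubseteq> m0" and be: "compatible_below L m0"
    and upD: "uniquely_paired (interval L \<bottom> m0)"
    and ex1: "\<exists>!i. i \<in> M_set (interval L \<bottom> m0) x \<inter> J_set (interval L \<bottom> m0) y"
  shows "\<exists>!j. j \<in> M_set L x \<inter> J_set L y"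
proof -
  define D where "D = interval L \<bottom> m0"
  define B where "B = {m \<in> meet_irreducibles L. kappa_inv L m \<sqsubseteq> m0}"
  have xy: "x \<in> carrier L" "y \<in> carrier L" "x \<sqsubseteq> y"
    using cov by (auto simp: covered_by_def lless_eq)
  have xm0: "x \<sqsubseteq> m0"
    using le_trans[of x y m0] xy m0_closed \<open>y \<sqsubseteq> m0\<close> by simp
  have bij: "bij_betw (\<lambda>m. m0 \<sqinter> m) B (meet_irreducibles D)"
    and kap: "\<And>m. m \<in> B \<Longrightarrow> kappa_inv D (m0 \<sqinter> m) = kappa_inv L m"
    using be by (simp_all add: compatible_below_def Let_def D_def B_def)
  note upD = upD[folded D_def]
  \<comment> \<open>Since \<open>x \<sqsubseteq> m0\<close>, replacing \<open>m\<close> by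
    \<open>m0 \<sqinter> m\<close> does not affect whether it is above \<open>x\<close>.\<close>
  have meet_iff: "x \<sqsubseteq> m0 \<sqinter> m \<longleftrightarrow> x \<sqsubseteq> m" if "m \<in> carrier L" for m
    using le_trans[of x "m0 \<sqinter> m" m] meet_right[of m0 m] meet_le[of x m0 m] that
      xy m0_closed xm0 by auto
  have "M_set L x \<inter> J_set L y = M_set D x \<inter> J_set D y"
  proof (rule Set.set_eqI)
    fix j
    show "j \<in> M_set L x \<inter> J_set L y \<longleftrightarrow> j \<in> M_set D x \<inter> J_set D y"
    proof
      assume "j \<in> M_set L x \<inter> J_set L y"
      then have j: "j \<in> join_irreducibles L" "x \<sqsubseteq> kappa L j" "j \<sqsubseteq> y"
        by (simp_all add: M_set_def J_set_def)
      then have "j \<sqsubseteq> m0"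
        using le_trans[of j y m0] xy m0_closed \<open>y \<sqsubseteq> m0\<close> by (simp add: join_irreducibles_closed)
      with j have B: "kappa L j \<in> B"
        by (simp add: B_def kappa_mem kappa_inv_kappa up)
      then have M: "m0 \<sqinter> kappa L j \<in> meet_irreducibles D"
        using bij_betwE[OF bij] by blast
      moreover have "kappa_inv D (m0 \<sqinter> kappa L j) = j"
        using kap[OF B] j by (simp add: kappa_inv_kappa up)
      ultimately have "j \<in> join_irreducibles D" "kappa D j = m0 \<sqinter> kappa L j"
        using kappa_inv_mem[OF upD M] kappa_kappa_inv[OF upD M] by simp_all
      then show "j \<in> M_set D x \<inter> J_set D y"
        using j meet_iff[of "kappa L j"] by (simp add: M_set_def J_set_def D_def kappa_closed up)
    next
      assume "j \<in> M_set D x \<inter> J_set D y"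
      then have j: "j \<in> join_irreducibles D" "x \<sqsubseteq> kappa D j" "j \<sqsubseteq> y"
        by (simp_all add: M_set_def J_set_def D_def)
      obtain m where m: "m \<in> B" "kappa D j = m0 \<sqinter> m"
        using bij_betw_imp_surj_on[OF bij] kappa_mem[OF upD j(1)] by auto
      then have "j = kappa_inv L m" "m \<in> meet_irreducibles L"
        using kap[of m] kappa_inv_kappa[OF upD j(1)] by (simp_all add: B_def)
      then have "j \<in> join_irreducibles L" "kappa L j = m"
        by (simp_all add: kappa_inv_mem kappa_kappa_inv up)
      then show "j \<in> M_set L x \<inter> J_set L y"
        using j m meet_iff[of m] kappa_closed[OF up, of j] by (simp add: M_set_def J_set_def)
    qed
  qed
  then show ?thesis
    using ex1 by (simp add: D_def)
qed

text \<open>Here \<open>j0\<close> is the only label: any other \<open>j\<close> would lie strictly above \<open>j0\<close>, so that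
  \<open>j0 \<sqsubseteq> j\<^sub>* \<sqsubseteq> \<kappa>(j)\<close>, although \<open>y \<sqinter> \<kappa>(j) = x\<close>.\<close>

lemma label_across:
  assumes cov: "covered_by L x y" and "x \<sqsubseteq> m0" "j0 \<sqsubseteq> y"
  shows "\<exists>!j. j \<in> M_set L x \<inter> J_set L y"
proof (rule ex1I)
  show "j0 \<in> M_set L x \<inter> J_set L y"
    using assms j0_join_irreducible kappa_j0 by (simp add: M_set_def J_set_def)
next
  fix j assume "j \<in> M_set L x \<inter> J_set L y"
  then have j: "j \<in> join_irreducibles L" "x \<sqsubseteq> kappa L j" "j \<sqsubseteq> y"
    by (simp_all add: M_set_def J_set_def)
  have xy: "x \<in> carrier L" "y \<in> carrier L" "x \<sqsubseteq> y" "x \<noteq> y"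
    and btw: "\<And>z. z \<in> carrier L \<Longrightarrow> x \<sqsubseteq> z \<Longrightarrow> z \<sqsubseteq> y \<Longrightarrow> z = x \<or> z = y"
    using cov by (auto simp: covered_by_def lless_eq)
  have jc: "j \<in> carrier L" "kappa L j \<in> carrier L"
    using j by (simp_all add: join_irreducibles_closed kappa_closed up)
  have njk: "\<not> j \<sqsubseteq> kappa L j"
    using j by (simp add: not_le_kappa up)
  have "\<not> y \<sqsubseteq> kappa L j"
    using njk le_trans[of j y "kappa L j"] j jc xy by auto
  \<comment> \<open>This meet lies between \<open>x\<close> and \<open>y\<close> and is not
    \<open>y\<close>.\<close>
  have "y \<sqinter> kappa L j = x"
    using btw[of "y \<sqinter> kappa L j"] \<open>\<not> y \<sqsubseteq> kappa L j\<close> meet_le[of x y "kappa L j"]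
      meet_left[of y "kappa L j"] meet_right[of y "kappa L j"] j jc xy by auto
  \<comment> \<open>Otherwise \<open>j0\<close> would be below this meet, which is
    \<open>x \<sqsubseteq> m0\<close>.\<close>
  then have "\<not> j0 \<sqsubseteq> kappa L j"
    using meet_le[of j0 y "kappa L j"] le_m0_iff[of x] assms xy jc j0_closed by auto
  \<comment> \<open>Otherwise
    \<open>j \<sqsubseteq> y \<sqinter> m0 = x \<sqsubseteq> kappa L j\<close>.\<close>
  have "\<not> j \<sqsubseteq> m0"
  proof
    assume "j \<sqsubseteq> m0"
    have "y \<sqinter> m0 = x"
      using btw[of "y \<sqinter> m0"] le_m0_iff[of y] meet_le[of x y m0]
        meet_left[of y m0] meet_right[of y m0] assms xy m0_closed by auto
    then have "j \<sqsubseteq> x"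
      using meet_le[of j y m0] \<open>j \<sqsubseteq> m0\<close> j jc xy m0_closed by auto
    then show False
      using njk le_trans[of j x "kappa L j"] j jc xy by auto
  qed
  then have "j0 \<sqsubseteq> j"
    using le_m0_iff[of j] jc by simp
  show "j = j0"
  proof (rule ccontr)
    assume "j \<noteq> j0"
    then have "j0 \<sqsubseteq> lower_cover L j"
      using le_lower_cover[of j j0] \<open>j0 \<sqsubseteq> j\<close> j j0_closed by auto
    also have "lower_cover L j = j \<sqinter> kappa L j"
      using meet_partnersD[OF kappa_meet_partner[OF up j(1)]] by simp
    finally have "j0 \<sqsubseteq> kappa L j"
      using le_trans[of j0 "j \<sqinter> kappa L j" "kappa L j"] meet_right[of j "kappa L j"] jc j0_closed
      by simp
    with \<open>\<not> j0 \<sqsubseteq> kappa L j\<close> show False ..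
  qed
qed

end

text \<open>This gives the \<open>THE\<close> in \<open>cover_label\<close> its meaning. A cover
  lies in the upper interval, lies in the lower one, or crosses between them; the first two cases
  are inductive.\<close>

lemma ex1_cover_label:
  fixes L :: "'a gorder"
  assumes "compatibly_dismantlable L" "covered_by L x y"
  shows "\<exists>!j. j \<in> M_set L x \<inter> J_set L y"
  using assms
proof (induction L arbitrary: x y rule: compatibly_dismantlable.induct)
  case (trivial L)
  interpret fin_lat L
    using trivial by (simp add: fin_lat_if_uniquely_paired)
  obtain a where "carrier L = {a}"
    using \<open>card (carrier L) = 1\<close> by (rule card_1_singletonE)
  then have "\<not> covered_by L x y"
    by (auto simp: covered_by_def lless_eq)
  with trivial.prems show ?case by simp
next
  case (dismantle L j0 m0)
  interpret prime_paired L j0 m0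
    using dismantle.hyps
    by (simp add: prime_paired_def prime_paired_axioms_def fin_lat_if_uniquely_paired)
  have xy: "x \<in> carrier L" "y \<in> carrier L"
    using dismantle.prems by (auto simp: covered_by_def)
  consider "j0 \<sqsubseteq>\<^bsub>L\<^esub> x" | "y \<sqsubseteq>\<^bsub>L\<^esub> m0" | "x \<sqsubseteq>\<^bsub>L\<^esub> m0" "j0 \<sqsubseteq>\<^bsub>L\<^esub> y"
    using le_m0_iff xy by blast
  then show ?case
  proof cases
    case 1
    then show ?thesis
      using dismantle xy covered_by_interval[of x y j0 "\<top>\<^bsub>L\<^esub>"] j0_closed
      by (intro label_above) auto
  next
    case 2
    then show ?thesis
      using dismantle xy covered_by_interval[of x y "\<bottom>\<^bsub>L\<^esub>" m0] m0_closed
      by (intro label_below) (auto intro: uniquely_paired_if_compatibly_dismantlable)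
  next
    case 3
    then show ?thesis
      using dismantle.prems by (intro label_across)
  qed
qed

lemma cover_label_eq:
  "compatibly_dismantlable L \<Longrightarrow> covered_by L x y \<Longrightarrow> j \<in> M_set L x \<inter> J_set L y \<Longrightarrow> cover_label L x y = j"
  unfolding cover_label_def by (rule the1_equality[OF ex1_cover_label])

lemma cover_label_mem:
  "compatibly_dismantlable L \<Longrightarrow> covered_by L x y \<Longrightarrow> cover_label L x y \<in> M_set L x \<inter> J_set L y"
  unfolding cover_label_def by (rule theI'[OF ex1_cover_label])

section \<open>Products of semidistrim lattices\<close>

context two_uniquely_paired
begin

lemma M_set_prod:
  assumes "x \<in> carrier L" "x' \<in> carrier L'"
  shows "M_set P (x, x') = M_set L x \<times> {\<bottom>\<^bsub>L'\<^esub>} \<union> {\<bottom>\<^bsub>L\<^esub>} \<times> M_set L' x'"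
  using assms by (auto simp: M_set_def join_irreducibles_prod kappa_prod)

lemma J_set_prod:
  assumes "x \<in> carrier L" "x' \<in> carrier L'"
  shows "J_set P (x, x') = J_set L x \<times> {\<bottom>\<^bsub>L'\<^esub>} \<union> {\<bottom>\<^bsub>L\<^esub>} \<times> J_set L' x'"
  using assms by (auto simp: J_set_def join_irreducibles_prod)

lemma independent_in_prod:
  assumes S: "independent_in (galois_graph L) S" and S': "independent_in (galois_graph L') S'"
  shows "independent_in (galois_graph P) (S \<times> {\<bottom>\<^bsub>L'\<^esub>} \<union> {\<bottom>\<^bsub>L\<^esub>} \<times> S')"
proof -
  have sub: "S \<subseteq> join_irreducibles L" "S' \<subseteq> join_irreducibles L'"
    using S S' by (simp_all add: independent_in_def galois_graph_def)
  have le: "i \<sqsubseteq>\<^bsub>L\<^esub> kappa L j" if "i \<in> S" "j \<in> S" "i \<noteq> j" for i j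
    using that S subsetD[OF sub(1)] by (auto simp: independent_in_def galois_graph_def)
  have le': "i \<sqsubseteq>\<^bsub>L'\<^esub> kappa L' j" if "i \<in> S'" "j \<in> S'" "i \<noteq> j" for i j
    using that S' subsetD[OF sub(2)] by (auto simp: independent_in_def galois_graph_def)
  have closed: "i \<in> carrier L \<and> kappa L i \<in> carrier L" if "i \<in> S" for i
    using that sub by (auto simp: A.join_irreducibles_closed kappa_closed up)
  have closed': "i \<in> carrier L' \<and> kappa L' i \<in> carrier L'" if "i \<in> S'" for i
    using that sub by (auto simp: B.join_irreducibles_closed kappa_closed up')
  \<comment> \<open>Within one factor this is \<open>le\<close> or \<open>le'\<close>; for a mixed
    pair, one coordinate has \<open>\<top>\<close> on the right and the other has
    \<open>\<bottom>\<close> on the left.\<close>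
  have "p \<sqsubseteq>\<^bsub>P\<^esub> kappa P q" if "p \<noteq> q"
    "p \<in> S \<times> {\<bottom>\<^bsub>L'\<^esub>} \<union> {\<bottom>\<^bsub>L\<^esub>} \<times> S'" "q \<in> S \<times> {\<bottom>\<^bsub>L'\<^esub>} \<union> {\<bottom>\<^bsub>L\<^esub>} \<times> S'" for p q
    using that sub closed closed' le le' by (auto simp: kappa_prod subset_iff)
  moreover have "S \<times> {\<bottom>\<^bsub>L'\<^esub>} \<union> {\<bottom>\<^bsub>L\<^esub>} \<times> S' \<subseteq> join_irreducibles P"
    using sub by (auto simp: join_irreducibles_prod)
  ultimately show ?thesis
    by (auto simp: independent_in_def galois_graph_def)
qed

context
  assumes cd: "compatibly_dismantlable L" and cd': "compatibly_dismantlable L'"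
begin

text \<open>The product is compatibly dismantlable, so its labels are unique, and it suffices that
  the lifted label lies in both sets.\<close>

lemma cover_label_prod:
  shows "covered_by L x y \<Longrightarrow> x' \<in> carrier L' \<Longrightarrow>
      cover_label P (x, x') (y, x') = (cover_label L x y, \<bottom>\<^bsub>L'\<^esub>)"
    and "x \<in> carrier L \<Longrightarrow> covered_by L' x' y' \<Longrightarrow>
      cover_label P (x, x') (x, y') = (\<bottom>\<^bsub>L\<^esub>, cover_label L' x' y')"
proof -
  show "cover_label P (x, x') (y, x') = (cover_label L x y, \<bottom>\<^bsub>L'\<^esub>)"
    if "covered_by L x y" "x' \<in> carrier L'"
  proof (rule cover_label_eq[OF compatibly_dismantlable_prod[OF cd cd']])
    have "x \<in> carrier L" "y \<in> carrier L"
      using that by (auto simp: covered_by_def)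
    then show "(cover_label L x y, \<bottom>\<^bsub>L'\<^esub>) \<in> M_set P (x, x') \<inter> J_set P (y, x')"
      using cover_label_mem[OF cd that(1)] that(2) by (simp add: M_set_prod J_set_prod)
  qed (use that in \<open>simp add: covered_by_prod\<close>)
  show "cover_label P (x, x') (x, y') = (\<bottom>\<^bsub>L\<^esub>, cover_label L' x' y')"
    if "x \<in> carrier L" "covered_by L' x' y'"
  proof (rule cover_label_eq[OF compatibly_dismantlable_prod[OF cd cd']])
    have "x' \<in> carrier L'" "y' \<in> carrier L'"
      using that by (auto simp: covered_by_def)
    then show "(\<bottom>\<^bsub>L\<^esub>, cover_label L' x' y') \<in> M_set P (x, x') \<inter> J_set P (x, y')"
      using cover_label_mem[OF cd' that(2)] that(1) by (simp add: M_set_prod J_set_prod)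
  qed (use that in \<open>simp add: covered_by_prod\<close>)
qed

lemma down_labels_prod:
  assumes "x \<in> carrier L" "x' \<in> carrier L'"
  shows "down_labels P (x, x') = down_labels L x \<times> {\<bottom>\<^bsub>L'\<^esub>} \<union> {\<bottom>\<^bsub>L\<^esub>} \<times> down_labels L' x'"
proof -
  have "down_labels P (x, x') = {cover_label P (y, x') (x, x') | y. covered_by L y x} \<union>
      {cover_label P (x, y') (x, x') | y'. covered_by L' y' x'}"
    using assms by (auto simp: down_labels_def covered_by_prod)
  \<comment> \<open>\<open>rev_conj_cong\<close> makes the cover relation available while the label
    is rewritten.\<close>
  also have "{cover_label P (y, x') (x, x') | y. covered_by L y x} = down_labels L x \<times> {\<bottom>\<^bsub>L'\<^esub>}"
    using assms by (auto simp: down_labels_def cover_label_prod cong: rev_conj_cong)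
  also have "{cover_label P (x, y') (x, x') | y'. covered_by L' y' x'} = {\<bottom>\<^bsub>L\<^esub>} \<times> down_labels L' x'"
    using assms by (auto simp: down_labels_def cover_label_prod cong: rev_conj_cong)
  finally show ?thesis .
qed

lemma up_labels_prod:
  assumes "x \<in> carrier L" "x' \<in> carrier L'"
  shows "up_labels P (x, x') = up_labels L x \<times> {\<bottom>\<^bsub>L'\<^esub>} \<union> {\<bottom>\<^bsub>L\<^esub>} \<times> up_labels L' x'"
proof -
  have "up_labels P (x, x') = {cover_label P (x, x') (y, x') | y. covered_by L x y} \<union>
      {cover_label P (x, x') (x, y') | y'. covered_by L' x' y'}"
    using assms by (auto simp: up_labels_def covered_by_prod)
  also have "{cover_label P (x, x') (y, x') | y. covered_by L x y} = up_labels L x \<times> {\<bottom>\<^bsub>L'\<^esub>}"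
    using assms by (auto simp: up_labels_def cover_label_prod cong: rev_conj_cong)
  also have "{cover_label P (x, x') (x, y') | y'. covered_by L' x' y'} = {\<bottom>\<^bsub>L\<^esub>} \<times> up_labels L' x'"
    using assms by (auto simp: up_labels_def cover_label_prod cong: rev_conj_cong)
  finally show ?thesis .
qed

end

end

theorem theorem7p3:
  fixes L :: "'a gorder" and L' :: "'b gorder"
  assumes "semidistrim L" and "semidistrim L'"
  shows "semidistrim (prod_lattice L L')"
proof -
  have cd: "compatibly_dismantlable L" "compatibly_dismantlable L'"
    using assms by (simp_all add: semidistrim_def)
  then interpret two_uniquely_paired L L'
    by unfold_locales (simp_all add: uniquely_paired_if_compatibly_dismantlable)
  \<comment> \<open>Each label set of the product is the union of the lifted label sets of the
    factors, to which \<open>independent_in_prod\<close> applies.\<close>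
  show ?thesis
    using assms cd
    by (auto simp: semidistrim_def compatibly_dismantlable_prod down_labels_prod up_labels_prod
        intro!: independent_in_prod)
qed

end
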